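(* For every fixed $C>0$ there exist a real-valued function $f\in\bigcap_{1\le p<\infty}L^p(\mathbb T)$ with $\int_{\mathbb T} f=0$ and an increasing sequence of positive integers $(n_j)_{j\ge1}$ with $n_{j+1}/n_j\ge2$ for all $j$ such that $$\|f-S_Nf\|_2\ll (\log\log\log N)^{-C}$$ for all sufficiently large $N$, but $$\limsup_{N\to\infty}\frac1N\sum_{j\le N}f(n_jx)=+\infty$$ for almost every $x\in\mathbb T$.
   Context: $\mathbb T=\mathbb R/\mathbb Z$ with normalized Lebesgue measure; $\|\cdot\|_2$ is the $L^2(\mathbb T)$ norm. For $f\in L^2(\mathbb T)$, $S_Nf(x)=\sum_{|m|\le N}\widehat f(m)e^{2\pi i m x}$ is the symmetric Fourier partial sum. $A(N)\ll B(N)$ means $A(N)\le K\,B(N)$ for some constant $K>0$ independent of $N$. *)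

theory Defs
  imports "HOL-Analysis.Analysis"
begin

text \<open>
  Functions on the circle \<open>\<real>/\<int>\<close> are represented by 1-periodic functions on the reals, and the
  normalized Lebesgue measure by Lebesgue measure on the fundamental domain \<open>[0,1)\<close>.
  Membership in \<open>L\<^sup>p\<close> is a property of representatives; a.e. equal functions are not identified.
\<close>

definition circle_measure :: "real measure" where
  "circle_measure = lebesgue_on {0..<1}"

definition Lp_circle :: "real \<Rightarrow> (real \<Rightarrow> real) set" where
  "Lp_circle p = {f. (\<forall>x. f (x + 1) = f x) \<and> f \<in> borel_measurable circle_measure \<and>
     integrable circle_measure (\<lambda>x. \<bar>f x\<bar> powr p)}"

definition L2_norm_circle :: "(real \<Rightarrow> complex) \<Rightarrow> real" where
  "L2_norm_circle g = sqrt (LINT x|circle_measure. (cmod (g x))\<^sup>2)"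

definition fourier_coeff :: "(real \<Rightarrow> real) \<Rightarrow> int \<Rightarrow> complex" where
  "fourier_coeff f m =
     (LINT x|circle_measure. of_real (f x) * exp (- (2 * of_real pi * \<i> * of_int m * of_real x)))"

definition fourier_partial_sum :: "nat \<Rightarrow> (real \<Rightarrow> real) \<Rightarrow> real \<Rightarrow> complex" where
  "fourier_partial_sum N f x =
     (\<Sum>m = - int N..int N. fourier_coeff f m * exp (2 * of_real pi * \<i> * of_int m * of_real x))"

end

theory Submission
  imports Defs "HOL-Library.Discrete_Functions" "HOL-Library.Periodic_Fun" "HOL-Real_Asymp.Real_Asymp"
begin

text \<open>
  Stage \<open>k\<close> uses a base \<open>b = 2\<^sup>k H\<close>. Let \<open>S\<^sub>k\<close> be the set of \<open>x\<close> having a digit \<open>0\<close> among the first \<open>H\<close>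
  digits in base \<open>b\<close>; its measure is at most \<open>H / b = 1 / 2\<^sup>k\<close>. A single zero digit of \<open>x\<close> at
  position \<open>p\<close> puts all of \<open>b\<^sup>e x\<close>, \<open>p - H < e \<le> p\<close>, into \<open>S\<^sub>k\<close> simultaneously, so for a dyadic block
  of at most \<open>H / 2\<close> consecutive exponents \<open>e\<close> the probability that the whole block hits \<open>S\<^sub>k\<close> is still of
  order \<open>1 / 2\<^sup>k\<close>. Different blocks look at disjoint sets of digits and are hence independent; with
  \<open>3 \<sqdot> 4\<^sup>k\<close> dyadic blocks almost every point has a successful one, by Borel-Cantelli. For
  \<open>f = \<Sum>\<^sub>k k (1\<^bsub>S\<^sub>k\<^esub> - |S\<^sub>k|)\<close>, which is bounded below, the average of \<open>f(n\<^sub>j x)\<close> at the end of a successful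
  block is at least \<open>k / 2 - O(1)\<close>.

  The indicator of \<open>S\<^sub>k\<close> is a step function on a grid of \<open>b\<^sup>H\<close> points, a number that is triply
  exponential in \<open>k\<close>, whereas the part of \<open>f\<close> from stage \<open>k\<close> on is exponentially small in \<open>L\<^sup>2\<close>. Thus the
  Fourier tail decays exponentially in \<open>log log log N\<close>, for one \<open>f\<close> that serves all \<open>C\<close>.
\<close>

section \<open>Trigonometric approximation on the circle\<close>

lemma space_circle_measure [simp]: "space circle_measure = {0..<1}"
  by (simp add: circle_measure_def)

lemma finite_measure_circle: "finite_measure circle_measure"
  unfolding circle_measure_def
  by (intro finite_measure_lebesgue_on bounded_set_imp_lmeasurable) auto

lemma measure_space_circle [simp]: "measure circle_measure {0..<1} = 1"
  unfolding circle_measure_def by (simp add: measure_restrict_space)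

lemma measurable_circle:
  assumes "f \<in> borel_measurable borel"
  shows "f \<in> borel_measurable circle_measure"
  unfolding circle_measure_def using assms
  by (intro measurable_restrict_space1 measurable_completion) (simp add: measurable_lborel1)

lemma integrable_circle_bounded:
  fixes f :: "real \<Rightarrow> 'a :: {banach, second_countable_topology}"
  assumes "f \<in> borel_measurable circle_measure" "\<And>x. x \<in> {0..<1} \<Longrightarrow> norm (f x) \<le> B"
  shows "integrable circle_measure f"
  using assms by (intro finite_measure.integrable_const_bound[OF finite_measure_circle, where B = B] AE_I2) auto

lemma integrable_circle_continuous:
  fixes f :: "real \<Rightarrow> 'a :: euclidean_space"
  assumes "continuous_on UNIV f"
  shows "integrable circle_measure f"
proof -
  have "compact (f ` {0..1})"
    using assms continuous_on_subset by (intro compact_continuous_image) auto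
  then obtain B where "\<forall>x\<in>{0..1}. norm (f x) \<le> B"
    by (meson compact_imp_bounded bounded_iff imageI)
  then show ?thesis
    using assms by (intro integrable_circle_bounded[where B = B] measurable_circle
        borel_measurable_continuous_onI) auto
qed

lemma circle_integral_eq:
  fixes f :: "real \<Rightarrow> 'a :: euclidean_space"
  assumes "integrable circle_measure f" "(f has_integral I) {0..1}"
  shows "(LINT x|circle_measure. f x) = I"
proof -
  have "(LINT x|circle_measure. f x) = integral {0..<1} f"
    using assms(1) unfolding circle_measure_def by (intro lebesgue_integral_eq_integral) auto
  also have "\<dots> = integral {0..1} f"
    by (rule integral_spike_set) (auto intro: negligible_subset[of "{1}"])
  finally show ?thesis using assms(2) by (simp add: integral_unique)
qed

lemma circle_integral_FTC:
  fixes F f :: "real \<Rightarrow> 'a :: euclidean_space"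
  assumes "\<And>x. (F has_vector_derivative f x) (at x)" "continuous_on UNIV f"
  shows "(LINT x|circle_measure. f x) = F 1 - F 0"
  using assms by (intro circle_integral_eq integrable_circle_continuous fundamental_theorem_of_calculus)
    (auto intro: has_vector_derivative_at_within)

lemma circle_integral_lborel:
  fixes f :: "real \<Rightarrow> real"
  assumes "f \<in> borel_measurable borel"
  shows "(LINT x|circle_measure. f x) = (LINT x|lborel. indicator {0..<1} x * f x)"
proof -
  have "(LINT x|circle_measure. f x) = (LINT x|lebesgue. indicator {0..<1} x * f x)"
    unfolding circle_measure_def by (simp add: integral_restrict_space)
  also have "\<dots> = (LINT x|lborel. indicator {0..<1} x * f x)"
    using assms by (intro integral_completion) (auto simp: measurable_lborel1)
  finally show ?thesis .
qed

lemma integrable_indicator_bounded: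
  fixes f :: "real \<Rightarrow> real"
  assumes "f \<in> borel_measurable borel" "\<And>x. \<bar>f x\<bar> \<le> B"
  shows "integrable lborel (\<lambda>x. indicator {a..<b} x * f x)"
proof (rule Bochner_Integration.integrable_bound)
  show "integrable lborel (\<lambda>x. B * indicator {a..<b} x :: real)"
    by (cases "a \<le> b") auto
  show "AE x in lborel. norm (indicator {a..<b} x * f x) \<le> norm (B * indicator {a..<b} x :: real)"
    using assms(2) by (intro AE_I2) (auto simp: indicator_def intro: order_trans[OF _ abs_ge_self])
qed (use assms in auto)

text \<open>Substitution moves the domain to \<open>[-a, 1 - a)\<close>. The piece to the left of 0
  is carried by one period onto \<open>[1 - a, 1)\<close>, and the two pieces together fill
  \<open>[0, 1)\<close>.\<close>

lemma circle_integral_shift: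
  fixes f :: "real \<Rightarrow> real"
  assumes [measurable]: "f \<in> borel_measurable borel" and B: "\<And>x. \<bar>f x\<bar> \<le> B"
    and per: "\<And>x. f (x + 1) = f x" and a: "0 \<le> a" "a \<le> 1"
  shows "(LINT x|circle_measure. f (x - a)) = (LINT x|circle_measure. f x)"
proof -
  note int = integrable_indicator_bounded[OF assms(1) B]
  have "(LINT x|circle_measure. f (x - a)) = (LINT x|lborel. indicator {0..<1} x * f (x - a))"
    by (intro circle_integral_lborel) measurable
  also have "\<dots> = (LINT x|lborel. indicator {0..<1} (a + 1 * x) * f (a + 1 * x - a))"
    by (subst lborel_integral_real_affine[where c = 1 and t = a]) auto
  also have "\<dots> = (LINT x|lborel. indicator {-a..<0} x * f x + indicator {0..<1-a} x * f x)"
    using a by (intro Bochner_Integration.integral_cong) (auto simp: indicator_def)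
  also have "\<dots> = (LINT x|lborel. indicator {-a..<0} x * f x) + (LINT x|lborel. indicator {0..<1-a} x * f x)"
    by (intro Bochner_Integration.integral_add int)
  also have "(LINT x|lborel. indicator {-a..<0} x * f x)
      = (LINT x|lborel. indicator {-a..<0} (-1 + 1 * x) * f (-1 + 1 * x))"
    by (subst lborel_integral_real_affine[where c = 1 and t = "-1"]) auto
  also have "\<dots> = (LINT x|lborel. indicator {1-a..<1} x * f x)"
  proof (intro Bochner_Integration.integral_cong refl)
    fix x :: real
    have "f (-1 + 1 * x) = f x" using per[of "x - 1"] by simp
    then show "indicator {-a..<0} (-1 + 1 * x) * f (-1 + 1 * x) = indicator {1-a..<1} x * f x"
      by (auto simp: indicator_def)
  qed
  also have "(LINT x|lborel. indicator {1-a..<1} x * f x) + (LINT x|lborel. indicator {0..<1-a} x * f x)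
     = (LINT x|lborel. indicator {1-a..<1} x * f x + indicator {0..<1-a} x * f x)"
    by (intro Bochner_Integration.integral_add[symmetric] int)
  also have "\<dots> = (LINT x|lborel. indicator {0..<1} x * f x)"
    using a by (intro Bochner_Integration.integral_cong) (auto simp: indicator_def)
  also have "\<dots> = (LINT x|circle_measure. f x)"
    by (intro circle_integral_lborel[symmetric]) measurable
  finally show ?thesis .
qed

section \<open>Characters, Fourier coefficients and orthogonality\<close>

definition circle_char :: "int \<Rightarrow> real \<Rightarrow> complex" where
  "circle_char m x = exp (2 * of_real pi * \<i> * of_int m * of_real x)"

lemma circle_char_0 [simp]: "circle_char 0 x = 1"
  by (simp add: circle_char_def)

lemma circle_char_at_0 [simp]: "circle_char m 0 = 1"
  by (simp add: circle_char_def)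

lemma circle_char_mult: "circle_char m x * circle_char n x = circle_char (m + n) x"
  by (simp add: circle_char_def exp_add[symmetric] ring_distribs)

lemma circle_char_add: "circle_char m (x + y) = circle_char m x * circle_char m y"
  by (simp add: circle_char_def exp_add[symmetric] ring_distribs)

lemma cnj_circle_char: "cnj (circle_char m x) = circle_char (- m) x"
  by (simp add: circle_char_def exp_cnj)

lemma circle_char_of_int: "circle_char m (of_int n) = 1"
proof -
  have "circle_char m (of_int n) = exp (2 * of_int (m * n) * of_real pi * \<i>)"
    by (simp add: circle_char_def mult_ac)
  then show ?thesis using exp_integer_2pi[of "of_int (m * n)"] by simp
qed

lemma circle_char_add_1: "circle_char m (x + 1) = circle_char m x"
  using circle_char_of_int[of m 1] by (simp add: circle_char_add)

lemma norm_circle_char [simp]: "cmod (circle_char m x) = 1"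
  by (simp add: circle_char_def)

lemma continuous_on_circle_char [continuous_intros]: "continuous_on A (circle_char m)"
  unfolding circle_char_def by (intro continuous_intros)

lemma borel_measurable_circle_char [measurable]: "circle_char m \<in> borel_measurable borel"
  by (intro borel_measurable_continuous_onI continuous_intros)

lemma has_vector_derivative_circle_char:
  "(circle_char m has_vector_derivative (2 * of_real pi * \<i> * of_int m) * circle_char m x) (at x)"
  unfolding circle_char_def
  by (rule has_vector_derivative_real_field) (auto intro!: derivative_eq_intros)

lemma integral_circle_char: "(LINT x|circle_measure. circle_char m x) = (if m = 0 then 1 else 0)"
proof (cases "m = 0")
  case False
  have "(LINT x|circle_measure. (2 * of_real pi * \<i> * of_int m) * circle_char m x)
      = circle_char m 1 - circle_char m 0"
    by (intro circle_integral_FTC has_vector_derivative_circle_char continuous_intros)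
  also have "\<dots> = 0" using circle_char_of_int[of m 1] circle_char_of_int[of m 0] by simp
  finally show ?thesis using False by simp
qed simp


lemma fourier_coeff_circle_char:
  "fourier_coeff f m = (LINT x|circle_measure. of_real (f x) * circle_char (- m) x)"
  by (simp add: fourier_coeff_def circle_char_def)

lemma fourier_partial_sum_circle_char:
  "fourier_partial_sum N f x = (\<Sum>m = - int N..int N. fourier_coeff f m * circle_char m x)"
  by (simp add: fourier_partial_sum_def circle_char_def)

lemma integrable_circle_of_square:
  fixes f :: "real \<Rightarrow> real"
  assumes "f \<in> borel_measurable circle_measure" "integrable circle_measure (\<lambda>x. (f x)\<^sup>2)"
  shows "integrable circle_measure f"
proof (rule Bochner_Integration.integrable_bound)
  show "integrable circle_measure (\<lambda>x. 1 + (f x)\<^sup>2)"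
    by (intro Bochner_Integration.integrable_add assms(2) integrable_circle_bounded[where B = 1]) auto
  show "AE x in circle_measure. norm (f x) \<le> norm (1 + (f x)\<^sup>2)"
  proof (intro AE_I2)
    fix x
    have "0 \<le> (\<bar>f x\<bar> - 1)\<^sup>2" by simp
    then show "norm (f x) \<le> norm (1 + (f x)\<^sup>2)"
      by (auto simp: power2_eq_square algebra_simps)
  qed
qed (use assms in auto)

lemma integrable_circle_mult_char:
  assumes "integrable circle_measure f"
  shows "integrable circle_measure (\<lambda>x. of_real (f x) * circle_char m x)"
proof (rule Bochner_Integration.integrable_bound[OF assms])
  have [measurable]: "f \<in> borel_measurable circle_measure" "circle_char m \<in> borel_measurable circle_measure"
    using assms by (auto intro: measurable_circle)
  show "(\<lambda>x. of_real (f x) * circle_char m x) \<in> borel_measurable circle_measure"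
    by measurable
qed (auto simp: norm_mult)

text \<open>Expand the square, integrate using orthonormality of the characters, and complete the
  square in each \<open>p m\<close>. If \<open>p\<close> consists of the Fourier coefficients the
  last sum vanishes, so the identity yields both the best approximation property and the exact error
  of a partial sum.\<close>

lemma integral_trig_poly_dist:
  fixes f :: "real \<Rightarrow> real" and p :: "int \<Rightarrow> complex"
  assumes f: "f \<in> borel_measurable circle_measure" and f2: "integrable circle_measure (\<lambda>x. (f x)\<^sup>2)"
    and A: "finite A"
  shows "(LINT x|circle_measure. (cmod (of_real (f x) - (\<Sum>m\<in>A. p m * circle_char m x)))\<^sup>2)
     = (LINT x|circle_measure. (f x)\<^sup>2) - (\<Sum>m\<in>A. (cmod (fourier_coeff f m))\<^sup>2)
       + (\<Sum>m\<in>A. (cmod (fourier_coeff f m - p m))\<^sup>2)"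
proof -
  let ?c = "fourier_coeff f"
  have int_f: "integrable circle_measure f"
    using f f2 by (rule integrable_circle_of_square)
  have int1: "integrable circle_measure (\<lambda>x. cnj (p m) * (of_real (f x) * circle_char (- m) x))" for m
    by (intro integrable_mult_right integrable_circle_mult_char int_f)
  have int2: "integrable circle_measure (\<lambda>x. p m * cnj (p n) * circle_char (m - n) x)" for m n
    by (intro integrable_mult_right integrable_circle_continuous continuous_intros)
  let ?S1 = "\<lambda>x. \<Sum>m\<in>A. cnj (p m) * (of_real (f x) * circle_char (- m) x)"
  let ?S2 = "\<lambda>x. \<Sum>m\<in>A. \<Sum>n\<in>A. p m * cnj (p n) * circle_char (m - n) x"
  have pw: "(cmod (of_real (f x) - (\<Sum>m\<in>A. p m * circle_char m x)))\<^sup>2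
      = (f x)\<^sup>2 - 2 * Re (?S1 x) + Re (?S2 x)" for x
  proof -
    define P where "P = (\<Sum>m\<in>A. p m * circle_char m x)"
    have S1: "?S1 x = of_real (f x) * cnj P"
      by (simp add: P_def sum_distrib_left cnj_circle_char mult_ac)
    have S2: "?S2 x = P * cnj P"
      by (simp add: P_def sum_product cnj_circle_char circle_char_mult[of _ _ "- _", simplified, symmetric] mult_ac)
    show ?thesis
      unfolding S1 S2 P_def[symmetric] cmod_power2 by (simp add: power2_eq_square algebra_simps)
  qed
  have I1: "(LINT x|circle_measure. ?S1 x) = (\<Sum>m\<in>A. cnj (p m) * ?c m)"
    by (simp add: int1 fourier_coeff_circle_char)
  have I2: "(LINT x|circle_measure. ?S2 x) = (\<Sum>m\<in>A. p m * cnj (p m))"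
  proof -
    have "(LINT x|circle_measure. ?S2 x)
        = (\<Sum>m\<in>A. \<Sum>n\<in>A. (LINT x|circle_measure. p m * cnj (p n) * circle_char (m - n) x))"
      by (subst Bochner_Integration.integral_sum, intro Bochner_Integration.integrable_sum int2)
        (intro sum.cong refl Bochner_Integration.integral_sum int2)
    also have "\<dots> = (\<Sum>m\<in>A. \<Sum>n\<in>A. if n = m then p m * cnj (p n) else 0)"
      by (intro sum.cong) (auto simp: integral_circle_char)
    finally show ?thesis using A by (simp add: sum.delta')
  qed
  have "(LINT x|circle_measure. (f x)\<^sup>2 - 2 * Re (?S1 x) + Re (?S2 x))
     = (LINT x|circle_measure. (f x)\<^sup>2) - 2 * Re (LINT x|circle_measure. ?S1 x)
        + Re (LINT x|circle_measure. ?S2 x)"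
  proof -
    have "integrable circle_measure ?S1" "integrable circle_measure ?S2"
      by (intro Bochner_Integration.integrable_sum int1 int2)+
    then show ?thesis using f2 by (simp only: integral_Re integrable_Re integrable_mult_right
       integral_mult_right Bochner_Integration.integral_add Bochner_Integration.integral_diff
       Bochner_Integration.integrable_add Bochner_Integration.integrable_diff integral_mult_right_zero)
  qed
  also have "\<dots> = (LINT x|circle_measure. (f x)\<^sup>2)
       + (\<Sum>m\<in>A. (cmod (p m))\<^sup>2 - 2 * Re (cnj (p m) * ?c m))"
    unfolding I1 I2 cmod_power2 by (simp add: sum_subtractf sum_distrib_left power2_eq_square)
  also have "(\<Sum>m\<in>A. (cmod (p m))\<^sup>2 - 2 * Re (cnj (p m) * ?c m))
     = (\<Sum>m\<in>A. (cmod (?c m - p m))\<^sup>2 - (cmod (?c m))\<^sup>2)"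
    by (intro sum.cong refl, unfold cmod_power2) (simp add: power2_eq_square algebra_simps)
  finally show ?thesis unfolding pw by (simp add: sum_subtractf)
qed

section \<open>Trigonometric polynomials and best approximation\<close>

definition trig_polys :: "nat \<Rightarrow> (real \<Rightarrow> complex) set" where
  "trig_polys N = {P. \<exists>p. P = (\<lambda>x. \<Sum>m = - int N..int N. p m * circle_char m x)}"

text \<open>This reduces every upper bound for a Fourier tail to exhibiting one good trigonometric
  polynomial of degree at most \<open>N\<close>.\<close>

lemma fourier_partial_sum_best_approximation:
  assumes "f \<in> borel_measurable circle_measure" "integrable circle_measure (\<lambda>x. (f x)\<^sup>2)"
    and "P \<in> trig_polys N"
  shows "(LINT x|circle_measure. (cmod (of_real (f x) - fourier_partial_sum N f x))\<^sup>2)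
    \<le> (LINT x|circle_measure. (cmod (of_real (f x) - P x))\<^sup>2)"
proof -
  obtain p where "P = (\<lambda>x. \<Sum>m = - int N..int N. p m * circle_char m x)"
    using assms(3) unfolding trig_polys_def by blast
  then show ?thesis
    by (simp add: fourier_partial_sum_circle_char integral_trig_poly_dist[OF assms(1,2)] sum_nonneg)
qed

lemma fourier_partial_sum_trig_polys: "fourier_partial_sum N f \<in> trig_polys N"
  unfolding trig_polys_def fourier_partial_sum_circle_char by blast

lemma trig_polys_const: "(\<lambda>x. c) \<in> trig_polys N"
proof -
  have "(\<lambda>x. c) = (\<lambda>x. \<Sum>m = - int N..int N. (if m = 0 then c else 0) * circle_char m x)"
    by (simp add: if_distrib[of "\<lambda>z. z * _"] cong: if_cong)
  then show ?thesis unfolding trig_polys_def by (intro CollectI exI)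
qed

lemma trig_polys_add:
  assumes "P \<in> trig_polys N" "Q \<in> trig_polys N"
  shows "(\<lambda>x. P x + Q x) \<in> trig_polys N"
proof -
  obtain p q where "P = (\<lambda>x. \<Sum>m = - int N..int N. p m * circle_char m x)"
      "Q = (\<lambda>x. \<Sum>m = - int N..int N. q m * circle_char m x)"
    using assms unfolding trig_polys_def by blast
  then have "(\<lambda>x. P x + Q x) = (\<lambda>x. \<Sum>m = - int N..int N. (p m + q m) * circle_char m x)"
    by (simp add: ring_distribs sum.distrib)
  then show ?thesis unfolding trig_polys_def by (intro CollectI exI)
qed

lemma trig_polys_cmult:
  assumes "P \<in> trig_polys N"
  shows "(\<lambda>x. c * P x) \<in> trig_polys N"
proof -
  obtain p where "P = (\<lambda>x. \<Sum>m = - int N..int N. p m * circle_char m x)"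
    using assms unfolding trig_polys_def by blast
  then have "(\<lambda>x. c * P x) = (\<lambda>x. \<Sum>m = - int N..int N. (c * p m) * circle_char m x)"
    by (simp add: sum_distrib_left mult_ac)
  then show ?thesis unfolding trig_polys_def by (intro CollectI exI)
qed

lemma trig_polys_diff:
  assumes "P \<in> trig_polys N" "Q \<in> trig_polys N"
  shows "(\<lambda>x. P x - Q x) \<in> trig_polys N"
  using trig_polys_add[OF assms(1) trig_polys_cmult[OF assms(2), of "-1"]] by simp

lemma trig_polys_sum:
  assumes "\<And>i. i \<in> I \<Longrightarrow> P i \<in> trig_polys N"
  shows "(\<lambda>x. \<Sum>i\<in>I. P i x) \<in> trig_polys N"
  using assms by (induction I rule: infinite_finite_induct) (auto intro: trig_polys_const trig_polys_add)

lemma trig_polys_shift: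
  assumes "P \<in> trig_polys N"
  shows "(\<lambda>x. P (x - a)) \<in> trig_polys N"
proof -
  obtain p where "P = (\<lambda>x. \<Sum>m = - int N..int N. p m * circle_char m x)"
    using assms unfolding trig_polys_def by blast
  then have "(\<lambda>x. P (x - a))
      = (\<lambda>x. \<Sum>m = - int N..int N. (p m * circle_char m (- a)) * circle_char m x)"
    by (simp add: circle_char_add[of _ _ "- a", simplified] mult_ac)
  then show ?thesis unfolding trig_polys_def by (intro CollectI exI)
qed

lemma trig_polys_periodic: "P \<in> trig_polys N \<Longrightarrow> P (x + 1) = P x"
  unfolding trig_polys_def by (auto simp: circle_char_add_1)

lemma trig_polys_continuous: "P \<in> trig_polys N \<Longrightarrow> continuous_on A P"
  unfolding trig_polys_def by (auto intro!: continuous_intros)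

lemma trig_polys_bounded:
  assumes "P \<in> trig_polys N"
  obtains B where "\<And>x. cmod (P x) \<le> B"
proof -
  obtain p where P: "P = (\<lambda>x. \<Sum>m = - int N..int N. p m * circle_char m x)"
    using assms unfolding trig_polys_def by blast
  have "cmod (P x) \<le> (\<Sum>m = - int N..int N. cmod (p m))" for x
    unfolding P by (rule order_trans[OF norm_sum]) (simp add: norm_mult)
  then show ?thesis by (rule that)
qed

section \<open>The sawtooth, from whose translates grid step functions are assembled\<close>

definition sawtooth :: "real \<Rightarrow> real" where
  "sawtooth x = frac x - 1 / 2"

lemma sawtooth_measurable [measurable]: "sawtooth \<in> borel_measurable borel"
  unfolding sawtooth_def frac_def by measurable

lemma abs_sawtooth_le: "\<bar>sawtooth x\<bar> \<le> 1"
  using frac_ge_0[of x] frac_lt_1[of x] unfolding sawtooth_def by linarith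

lemma sawtooth_add_1: "sawtooth (x + 1) = sawtooth x"
  by (simp add: sawtooth_def frac_1_eq)

lemma sawtooth_eq: "x \<in> {0..<1} \<Longrightarrow> sawtooth x = x - 1 / 2"
  by (simp add: sawtooth_def frac_eq)

lemma integral_sawtooth_sq: "(LINT x|circle_measure. (sawtooth x)\<^sup>2) = 1 / 12"
proof -
  have "(LINT x|circle_measure. (sawtooth x)\<^sup>2) = (LINT x|circle_measure. (x - 1 / 2)\<^sup>2)"
    by (intro Bochner_Integration.integral_cong) (auto simp: sawtooth_eq)
  also have "\<dots> = (\<lambda>x. (x - 1 / 2) ^ 3 / 3) 1 - (\<lambda>x. (x - 1 / 2) ^ 3 / 3) 0"
    by (intro circle_integral_FTC[where F = "\<lambda>x. (x - 1 / 2) ^ 3 / 3"] continuous_intros,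
        unfold has_real_derivative_iff_has_vector_derivative[symmetric])
      (auto intro!: derivative_eq_intros simp: power2_eq_square power3_eq_cube)
  finally show ?thesis by (simp add: power3_eq_cube)
qed

text \<open>Integration by parts. The character takes the value 1 at both endpoints, so only the
  jump of the sawtooth survives and the coefficient equals \<open>1 / w\<close>.\<close>

lemma norm_fourier_coeff_sawtooth:
  assumes "m \<noteq> 0"
  shows "cmod (fourier_coeff sawtooth m) = 1 / (2 * pi * \<bar>of_int m\<bar>)"
proof -
  define w where "w = 2 * of_real pi * \<i> * of_int (- m)"
  have w: "w \<noteq> 0" using assms by (simp add: w_def)
  let ?F = "\<lambda>x::real. (of_real x - 1 / 2) * circle_char (- m) x / w - circle_char (- m) x / w\<^sup>2"
  have "fourier_coeff sawtooth m = (LINT x|circle_measure. (of_real x - 1 / 2) * circle_char (- m) x)"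
    unfolding fourier_coeff_circle_char
    by (intro Bochner_Integration.integral_cong) (auto simp: sawtooth_eq)
  also have "\<dots> = ?F 1 - ?F 0"
  proof (rule circle_integral_FTC)
    fix x :: real
    have "(circle_char (- m) has_vector_derivative w * circle_char (- m) x) (at x)"
      using has_vector_derivative_circle_char[of "- m" x] by (simp add: w_def)
    note [derivative_intros] = this
    have "(?F has_vector_derivative
        ((of_real x - 1 / 2) * (w * circle_char (- m) x) + 1 * circle_char (- m) x) / w
          - w * circle_char (- m) x / w\<^sup>2) (at x)"
      by (intro derivative_intros has_vector_derivative_mult has_vector_derivative_of_real)
        (auto intro!: derivative_eq_intros)
    also have "((of_real x - 1 / 2) * (w * circle_char (- m) x) + 1 * circle_char (- m) x) / w
          - w * circle_char (- m) x / w\<^sup>2 = (of_real x - 1 / 2) * circle_char (- m) x"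
      using w by (simp add: field_simps power2_eq_square)
    finally show "(?F has_vector_derivative (of_real x - 1 / 2) * circle_char (- m) x) (at x)" .
  qed (intro continuous_intros)
  also have "\<dots> = 1 / w"
    using circle_char_of_int[of "- m" 1] w by (simp add: divide_simps)
  finally show ?thesis by (simp add: w_def norm_divide norm_mult)
qed

text \<open>Each term \<open>1 / (n + 1)^2\<close> is at most the telescoping difference
  \<open>1 / n - 1 / (n + 1)\<close>; then the upper limit of summation tends to infinity and
  Euler's value of the series appears.\<close>

lemma sum_inverse_squares_tail:
  assumes "N \<ge> 1"
  shows "pi\<^sup>2 / 6 - (\<Sum>m = 1..N. 1 / (real m)\<^sup>2) \<le> 1 / real N"
proof -
  have "(\<Sum>m = 1..n. 1 / (real m)\<^sup>2) - (\<Sum>m = 1..N. 1 / (real m)\<^sup>2) \<le> 1 / real N - 1 / real n"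
    if "n \<ge> N" for n
    using that
  proof (induction n rule: dec_induct)
    case (step n)
    have "1 / (real (Suc n))\<^sup>2 \<le> 1 / (real n * real (Suc n))"
      using step assms by (intro divide_left_mono) (auto simp: power2_eq_square)
    also have "\<dots> = 1 / real n - 1 / real (Suc n)"
      using step assms by (simp add: field_simps)
    finally show ?case using step by simp
  qed simp
  then have le: "(\<Sum>m = 1..n. 1 / (real m)\<^sup>2) \<le> 1 / real N + (\<Sum>m = 1..N. 1 / (real m)\<^sup>2)"
    if "n \<ge> N" for n using that by (smt (verit) divide_nonneg_nonneg of_nat_0_le_iff)
  have "(\<lambda>n. \<Sum>k<n. 1 / (real k + 1)\<^sup>2) \<longlonglongrightarrow> pi\<^sup>2 / 6"
    using inverse_squares_sums by (simp add: sums_def add_ac)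
  also have "(\<lambda>n. \<Sum>k<n. 1 / (real k + 1)\<^sup>2) = (\<lambda>n. \<Sum>m = 1..n. 1 / (real m)\<^sup>2)"
    by (intro ext sum.reindex_bij_witness[of _ "\<lambda>m. m - 1" Suc]) (auto simp: add_ac)
  finally have lim: "(\<lambda>n. \<Sum>m = 1..n. 1 / (real m)\<^sup>2) \<longlonglongrightarrow> pi\<^sup>2 / 6" .
  have "pi\<^sup>2 / 6 \<le> 1 / real N + (\<Sum>m = 1..N. 1 / (real m)\<^sup>2)"
    by (rule LIMSEQ_le_const2[OF lim]) (use le in blast)
  then show ?thesis by simp
qed

text \<open>
  Parseval's identity for the sawtooth is the Basel identity, so no completeness of the
  trigonometric system is needed.
\<close>
lemma sawtooth_partial_sum_dist:
  assumes "N \<ge> 1"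
  shows "(LINT x|circle_measure. (cmod (of_real (sawtooth x) - fourier_partial_sum N sawtooth x))\<^sup>2)
    \<le> 1 / real N"
proof -
  let ?c = "\<lambda>m. (cmod (fourier_coeff sawtooth m))\<^sup>2"
  have "(LINT x|circle_measure. (cmod (of_real (sawtooth x) - fourier_partial_sum N sawtooth x))\<^sup>2)
      = 1 / 12 - (\<Sum>m = - int N..int N. ?c m)"
    unfolding fourier_partial_sum_circle_char
  proof (subst integral_trig_poly_dist)
    show "sawtooth \<in> borel_measurable circle_measure"
      by (intro measurable_circle sawtooth_measurable)
    show "integrable circle_measure (\<lambda>x. (sawtooth x)\<^sup>2)"
      using abs_sawtooth_le
      by (intro integrable_circle_bounded[where B = 1] measurable_circle) (auto simp: power_le_one_iff abs_square_le_1)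
  qed (auto simp: integral_sawtooth_sq)
  moreover have "(\<Sum>m = - int N..int N. ?c m) \<ge> (\<Sum>m\<in>(int ` {1..N} \<union> (\<lambda>m. - int m) ` {1..N}). ?c m)"
    by (intro sum_mono2) auto
  moreover have "(\<Sum>m\<in>(int ` {1..N} \<union> (\<lambda>m. - int m) ` {1..N}). ?c m)
      = (\<Sum>m = 1..N. ?c (int m)) + (\<Sum>m = 1..N. ?c (- int m))"
    by (subst sum.union_disjoint) (auto simp: sum.reindex inj_on_def)
  moreover have "(\<Sum>m = 1..N. ?c (int m)) = (\<Sum>m = 1..N. 1 / (real m)\<^sup>2) / (4 * pi\<^sup>2)"
    unfolding sum_divide_distrib
    by (intro sum.cong) (auto simp: norm_fourier_coeff_sawtooth power2_eq_square)
  moreover have "(\<Sum>m = 1..N. ?c (- int m)) = (\<Sum>m = 1..N. 1 / (real m)\<^sup>2) / (4 * pi\<^sup>2)"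
    unfolding sum_divide_distrib
    by (intro sum.cong) (auto simp: norm_fourier_coeff_sawtooth power2_eq_square)
  \<comment> \<open>The squared norm 1/12 is the full Parseval sum
    \<open>(pi^2 / 6) / (2 * pi^2)\<close>, so the error is bounded by a tail of the Basel
    series.\<close>
  moreover have "1 / 12 - (\<Sum>m = 1..N. 1 / (real m)\<^sup>2) / (2 * pi\<^sup>2)
      = (pi\<^sup>2 / 6 - (\<Sum>m = 1..N. 1 / (real m)\<^sup>2)) / (2 * pi\<^sup>2)"
    by (simp add: field_simps)
  moreover have "(pi\<^sup>2 / 6 - (\<Sum>m = 1..N. 1 / (real m)\<^sup>2)) / (2 * pi\<^sup>2) \<le> (1 / real N) / (2 * pi\<^sup>2)"
    by (intro divide_right_mono sum_inverse_squares_tail assms) auto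
  moreover have "(1 / real N) / (2 * pi\<^sup>2) \<le> (1 / real N) / 1"
  proof (intro divide_left_mono)
    have "1 * 1 \<le> pi * pi" using pi_gt3 by (intro mult_mono) auto
    then show "1 \<le> 2 * pi\<^sup>2" by (simp add: power2_eq_square)
  qed auto
  ultimately show ?thesis by linarith
qed

section \<open>Step functions on a grid and digit expansions\<close>

text \<open>On \<open>[0, 1)\<close> the sawtooth translated by \<open>c\<close> is
  \<open>x - c - 1 / 2\<close> plus a jump of 1 on \<open>x < c\<close>. Subtracting the translates
  to the two ends of a cell leaves the indicator of the cell minus its length, which the constant
  \<open>1 / real M\<close> restores.\<close>

lemma interval_eq_sawtooth:
  assumes "r < M" "x \<in> {0..<1}"
  shows "of_bool (nat \<lfloor>real M * x\<rfloor> = r)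
    = 1 / real M + (sawtooth (x - real (r + 1) / real M) - sawtooth (x - real r / real M))"
proof -
  define \<alpha> where "\<alpha> = real r / real M"
  define \<beta> where "\<beta> = real (r + 1) / real M"
  have M: "real M > 0" using assms by simp
  have \<alpha>\<beta>: "0 \<le> \<alpha>" "\<alpha> < \<beta>" "\<beta> \<le> 1" "\<beta> - \<alpha> = 1 / real M"
    using assms M by (auto simp: \<alpha>_def \<beta>_def field_simps)
  have saw: "sawtooth (x - c) = x - c - 1 / 2 + of_bool (x < c)" if "0 \<le> c" "c \<le> 1" for c
  proof (cases "x < c")
    case True
    have "frac (x - c) = x - c + 1"
      using that True assms by (subst frac_unique_iff) auto
    then show ?thesis using True by (simp add: sawtooth_def)
  next
    case False
    have "frac (x - c) = x - c"
      using that False assms by (subst frac_eq) auto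
    then show ?thesis using False by (simp add: sawtooth_def)
  qed
  have "nat \<lfloor>real M * x\<rfloor> = r \<longleftrightarrow> \<lfloor>real M * x\<rfloor> = int r"
    using assms by (auto simp: nat_eq_iff)
  also have "\<dots> \<longleftrightarrow> \<alpha> \<le> x \<and> x < \<beta>"
    using M by (simp add: floor_eq_iff \<alpha>_def \<beta>_def field_simps)
  finally show ?thesis
    using saw[of \<alpha>] saw[of \<beta>] \<alpha>\<beta> unfolding \<alpha>_def[symmetric] \<beta>_def[symmetric] by auto
qed

text \<open>The indicator is a sum of at most \<open>M\<close> cell indicators, each a difference of
  two sawtooth translates up to a constant. Cauchy-Schwarz over the cells costs a factor
  \<open>M\<close>, and each cell contributes at most \<open>4 / N\<close> by translation
  invariance. The crude factor \<open>M^2\<close> is harmless because \<open>N\<close> will be at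
  least \<open>M^4\<close>.\<close>

lemma step_function_trig_approximation:
  assumes M: "M \<ge> 1" and N: "N \<ge> 1" and R: "R \<subseteq> {..<M}"
  obtains P where "P \<in> trig_polys N"
    "(LINT x|circle_measure. (cmod (of_bool (nat \<lfloor>real M * x\<rfloor> \<in> R) - P x))\<^sup>2)
       \<le> 4 * (real M)\<^sup>2 / real N"
proof -
  let ?Q = "fourier_partial_sum N sawtooth"
  have Q: "?Q \<in> trig_polys N" by (rule fourier_partial_sum_trig_polys)
  define D where "D x = of_real (sawtooth x) - ?Q x" for x
  \<comment> \<open>The exact sawtooth formula for the indicator, with every sawtooth replaced by
    its partial sum.\<close>
  define P where "P x = (\<Sum>r\<in>R. of_real (1 / real M) + (?Q (x - real (r + 1) / real M) - ?Q (x - real r / real M)))" for x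
  have P: "P \<in> trig_polys N"
    unfolding P_def by (intro trig_polys_sum trig_polys_add trig_polys_const trig_polys_diff trig_polys_shift Q)
  have [measurable]: "?Q \<in> borel_measurable borel"
    by (intro borel_measurable_continuous_onI trig_polys_continuous[OF Q])
  have D_meas [measurable]: "D \<in> borel_measurable borel"
    unfolding D_def by measurable
  obtain B0 where B0: "\<And>x. cmod (?Q x) \<le> B0" using trig_polys_bounded[OF Q] by blast
  define B where "B = (1 + B0)\<^sup>2"
  have D_bound: "(cmod (D x))\<^sup>2 \<le> B" for x
  proof -
    have "cmod (D x) \<le> 1 + B0"
      unfolding D_def using abs_sawtooth_le[of x] B0[of x]
      by (intro order_trans[OF norm_triangle_ineq4]) auto
    then show ?thesis unfolding B_def by (intro power_mono) auto
  qed
  have int_D: "integrable circle_measure (\<lambda>x. (cmod (D (x - a)))\<^sup>2)" for a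
    using D_bound by (intro integrable_circle_bounded[where B = B] measurable_circle) auto
  have shift: "(LINT x|circle_measure. (cmod (D (x - a)))\<^sup>2) \<le> 1 / real N" if "0 \<le> a" "a \<le> 1" for a
  proof -
    have "(LINT x|circle_measure. (cmod (D (x - a)))\<^sup>2) = (LINT x|circle_measure. (cmod (D x))\<^sup>2)"
    proof (rule circle_integral_shift[where B = B])
      show "(cmod (D (x + 1)))\<^sup>2 = (cmod (D x))\<^sup>2" for x
        unfolding D_def by (simp add: sawtooth_add_1 trig_polys_periodic[OF Q])
    qed (use D_bound that in auto)
    then show ?thesis using sawtooth_partial_sum_dist[OF N] by (simp add: D_def)
  qed
  let ?E = "\<lambda>r x. (cmod (D (x - real (r + 1) / real M)))\<^sup>2 + (cmod (D (x - real r / real M)))\<^sup>2"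
  have int_E: "integrable circle_measure (?E r)" for r
    by (intro Bochner_Integration.integrable_add int_D)
  have pw: "(cmod (of_bool (nat \<lfloor>real M * x\<rfloor> \<in> R) - P x))\<^sup>2 \<le> real M * (\<Sum>r\<in>R. 2 * ?E r x)"
    if x: "x \<in> {0..<1}" for x
  proof -
    have fin: "finite R" using R finite_subset by blast
    have "(of_bool (nat \<lfloor>real M * x\<rfloor> \<in> R) :: real) = (\<Sum>r\<in>R. of_bool (nat \<lfloor>real M * x\<rfloor> = r))"
      using fin by (auto simp: of_bool_def sum.delta)
    also have "\<dots> = (\<Sum>r\<in>R. 1 / real M + (sawtooth (x - real (r + 1) / real M) - sawtooth (x - real r / real M)))"
      using R x by (intro sum.cong interval_eq_sawtooth) auto
    finally have "complex_of_real (of_bool (nat \<lfloor>real M * x\<rfloor> \<in> R)) - P x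
      = complex_of_real (\<Sum>r\<in>R. 1 / real M + (sawtooth (x - real (r + 1) / real M) - sawtooth (x - real r / real M))) - P x"
      by simp
    also have "\<dots> = (\<Sum>r\<in>R. D (x - real (r + 1) / real M) - D (x - real r / real M))"
      unfolding P_def D_def of_real_sum sum_subtractf[symmetric]
      by (intro sum.cong refl) (simp add: algebra_simps)
    finally have "of_bool (nat \<lfloor>real M * x\<rfloor> \<in> R) - P x
        = (\<Sum>r\<in>R. D (x - real (r + 1) / real M) - D (x - real r / real M))"
      by (cases "nat \<lfloor>real M * x\<rfloor> \<in> R") simp_all
    then have "(cmod (of_bool (nat \<lfloor>real M * x\<rfloor> \<in> R) - P x))\<^sup>2
        \<le> (\<Sum>r\<in>R. cmod (D (x - real (r + 1) / real M) - D (x - real r / real M)))\<^sup>2"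
      by (intro power_mono) (auto intro: norm_sum)
    also have "\<dots> \<le> (\<Sum>r\<in>R. (cmod (D (x - real (r + 1) / real M) - D (x - real r / real M)))\<^sup>2) * real (card R)"
      using sum_squared_le_sum_of_squares[of "\<lambda>r. cmod (D (x - real (r + 1) / real M) - D (x - real r / real M))" R]
      by (simp add: mult.commute)
    also have "\<dots> \<le> (\<Sum>r\<in>R. 2 * ?E r x) * real M"
    proof (intro mult_mono sum_mono)
      fix r assume "r \<in> R"
      let ?u = "D (x - real (r + 1) / real M)" and ?v = "D (x - real r / real M)"
      have "(cmod (?u - ?v))\<^sup>2 \<le> (cmod ?u + cmod ?v)\<^sup>2"
        by (intro power_mono norm_triangle_ineq4) auto
      moreover have "0 \<le> (cmod ?u - cmod ?v)\<^sup>2" by simp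
      ultimately show "(cmod (?u - ?v))\<^sup>2 \<le> 2 * ?E r x"
        by (simp add: power2_eq_square algebra_simps)
    next
      show "real (card R) \<le> real M"
        using card_mono[OF _ R] by simp
    qed (auto intro: sum_nonneg)
    finally show ?thesis by (simp add: mult.commute)
  qed
  have int_rhs: "integrable circle_measure (\<lambda>x. real M * (\<Sum>r\<in>R. 2 * ?E r x))"
    by (intro integrable_mult_right Bochner_Integration.integrable_sum int_E)
  have "(LINT x|circle_measure. (cmod (of_bool (nat \<lfloor>real M * x\<rfloor> \<in> R) - P x))\<^sup>2)
      \<le> (LINT x|circle_measure. real M * (\<Sum>r\<in>R. 2 * ?E r x))"
    using pw by (intro integral_mono' int_rhs) (auto intro!: mult_nonneg_nonneg sum_nonneg)
  also have "\<dots> = real M * (\<Sum>r\<in>R. 2 * ((LINT x|circle_measure. (cmod (D (x - real (r + 1) / real M)))\<^sup>2)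
        + (LINT x|circle_measure. (cmod (D (x - real r / real M)))\<^sup>2)))"
    by (simp only: integral_mult_right_zero Bochner_Integration.integral_sum integrable_mult_right
        Bochner_Integration.integral_add int_D Bochner_Integration.integrable_add)
  also have "\<dots> \<le> real M * (\<Sum>r\<in>R. 2 * (1 / real N + 1 / real N))"
  proof (intro mult_left_mono sum_mono add_mono shift)
    fix r assume "r \<in> R"
    then have "r < M" using R by auto
    then show "real (r + 1) / real M \<le> 1" "real r / real M \<le> 1" by auto
  qed auto
  also have "\<dots> = real M * (real (card R) * (4 / real N))" by simp
  also have "\<dots> \<le> real M * (real M * (4 / real N))"
    using card_mono[OF _ R] by (intro mult_left_mono mult_right_mono) auto
  finally show ?thesis using P by (intro that) (auto simp: power2_eq_square mult_ac)
qed

section \<open>Measures of grid sets and independence of digits\<close>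

lemma sets_circle_borel:
  assumes "A \<in> sets borel"
  shows "{x \<in> {0..<1}. x \<in> A} \<in> sets circle_measure"
  unfolding circle_measure_def sets_restrict_space using assms by (auto simp: Int_def)

lemma measure_circle_interval:
  assumes "0 \<le> a" "a \<le> b" "b \<le> 1"
  shows "measure circle_measure {a..<b} = b - a"
  unfolding circle_measure_def using assms by (subst measure_restrict_space) auto

lemma nat_floor_grid_less:
  assumes "x \<in> {0..<1}" "M \<ge> 1"
  shows "nat \<lfloor>real M * x\<rfloor> < M"
proof -
  have "real M * x < real M * 1" using assms by (intro mult_strict_left_mono) auto
  then show ?thesis using assms by (subst nat_less_iff) (auto simp: floor_less_iff)
qed

text \<open>The set is a disjoint union of \<open>card R\<close> half-open cells of length
  \<open>1 / M\<close>, so measure becomes counting.\<close>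

lemma measure_grid_set:
  assumes R: "R \<subseteq> {..<M}"
  shows "measure circle_measure {x \<in> {0..<1}. nat \<lfloor>real M * x\<rfloor> \<in> R} = real (card R) / real M"
proof -
  have fin: "finite R" using R finite_subset by blast
  let ?I = "\<lambda>r. {real r / real M..<real (r + 1) / real M}"
  have pt: "x \<in> {0..<1} \<and> nat \<lfloor>real M * x\<rfloor> = r \<longleftrightarrow> x \<in> ?I r" if "r \<in> R" for x r
  proof -
    have M: "real M > 0" "r < M" using that R by auto
    have "real (r + 1) / real M \<le> 1" "0 \<le> real r / real M" using M by auto
    then have "x \<in> ?I r \<Longrightarrow> x \<in> {0..<1}" unfolding atLeastLessThan_iff by linarith
    moreover have "x \<in> {0..<1} \<Longrightarrow> nat \<lfloor>real M * x\<rfloor> = r \<longleftrightarrow> x \<in> ?I r"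
      using M by (auto simp: nat_eq_iff floor_eq_iff field_simps)
    ultimately show ?thesis by blast
  qed
  have "{x \<in> {0..<1}. nat \<lfloor>real M * x\<rfloor> \<in> R} = (\<Union>r\<in>R. ?I r)"
  proof (intro set_eqI iffI)
    fix x assume "x \<in> {x \<in> {0..<1}. nat \<lfloor>real M * x\<rfloor> \<in> R}"
    then show "x \<in> (\<Union>r\<in>R. ?I r)" using pt[of "nat \<lfloor>real M * x\<rfloor>" x] by blast
  next
    fix x assume "x \<in> (\<Union>r\<in>R. ?I r)"
    then obtain r where "r \<in> R" "x \<in> ?I r" by blast
    then show "x \<in> {x \<in> {0..<1}. nat \<lfloor>real M * x\<rfloor> \<in> R}" using pt[of r x] by blast
  qed
  also have "measure circle_measure \<dots> = (\<Sum>r\<in>R. measure circle_measure (?I r))"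
  proof (rule measure_finite_Union[OF fin])
    show "?I ` R \<subseteq> sets circle_measure"
    proof
      fix A assume "A \<in> ?I ` R"
      then obtain r where r: "r \<in> R" "A = ?I r" by blast
      have "A = {x \<in> {0..<1}. x \<in> ?I r}" using pt[OF r(1)] r(2) by blast
      then show "A \<in> sets circle_measure" using sets_circle_borel[of "?I r"] by simp
    qed
    show "disjoint_family_on ?I R"
      unfolding disjoint_family_on_def disjoint_iff by (metis pt)
    show "emeasure circle_measure (?I r) \<noteq> \<infinity>" for r
      using finite_measure.emeasure_finite[OF finite_measure_circle] by simp
  qed
  also have "\<dots> = (\<Sum>r\<in>R. 1 / real M)"
  proof (intro sum.cong refl)
    fix r assume "r \<in> R"
    then have "r < M" using R by auto
    then show "measure circle_measure (?I r) = 1 / real M"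
      by (subst measure_circle_interval) (auto simp: field_simps)
  qed
  finally show ?thesis by simp
qed

text \<open>The digit with index \<open>i\<close> counts from 0 after the radix point. Phrasing it
  by divisibility of a floor makes sense for every real \<open>x\<close>, so no reduction modulo 1
  is needed after a dilation.\<close>

definition zero_digit :: "nat \<Rightarrow> nat \<Rightarrow> real set" where
  "zero_digit b i = {x. int b dvd \<lfloor>real b ^ (i + 1) * x\<rfloor>}"

lemma zero_digit_borel [measurable]: "zero_digit b i \<in> sets borel"
  unfolding zero_digit_def by measurable

lemma zero_digit_add_1: "x + 1 \<in> zero_digit b i \<longleftrightarrow> x \<in> zero_digit b i"
proof -
  have "real b ^ (i + 1) * (x + 1) = real b ^ (i + 1) * x + of_int (int b ^ (i + 1))"
    by (simp add: algebra_simps)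
  then have "\<lfloor>real b ^ (i + 1) * (x + 1)\<rfloor> = \<lfloor>real b ^ (i + 1) * x\<rfloor> + int b ^ (i + 1)"
    by (simp only: floor_add_int)
  then show ?thesis by (simp add: zero_digit_def dvd_add_left_iff)
qed

text \<open>Multiplication by a power of the base shifts the digits. This is how a single zero digit
  of \<open>x\<close> serves many dilates at once.\<close>

lemma zero_digit_power_mult: "real (b ^ e) * x \<in> zero_digit b i \<longleftrightarrow> x \<in> zero_digit b (e + i)"
  by (simp add: zero_digit_def power_add mult_ac)

text \<open>The first \<open>n\<close> digits of \<open>x\<close> are those of the integer
  \<open>nat \<lfloor>real (b ^ n) * x\<rfloor>\<close> in reverse numbering, so digit conditions
  describe sets of grid cells.\<close>

lemma zero_digit_iff_grid:
  assumes "i < n" "b \<ge> 1" "x \<ge> 0"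
  shows "x \<in> zero_digit b i \<longleftrightarrow> b dvd nat \<lfloor>real (b ^ n) * x\<rfloor> div b ^ (n - 1 - i)"
proof -
  have "real b ^ n = real b ^ (i + 1) * real b ^ (n - 1 - i)"
    using assms by (subst power_add[symmetric]) simp
  then have "\<lfloor>real b ^ (i + 1) * x\<rfloor> = \<lfloor>real (b ^ n) * x / real_of_int (int b ^ (n - 1 - i))\<rfloor>"
    using assms by (simp add: mult_ac)
  also have "\<dots> = \<lfloor>real (b ^ n) * x\<rfloor> div int b ^ (n - 1 - i)"
    by (intro floor_divide_real_eq_div) auto
  also have "\<dots> = int (nat \<lfloor>real (b ^ n) * x\<rfloor> div b ^ (n - 1 - i))"
    using assms by (simp add: zdiv_int)
  finally show ?thesis by (simp add: zero_digit_def)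
qed

text \<open>Induction on \<open>n\<close> by splitting off the last digit,
  \<open>r = q * b + d\<close>. The conditions with index below \<open>n\<close> concern only
  \<open>q\<close>, and index \<open>n\<close> merely forbids \<open>d = 0\<close>; this product
  structure is the independence of the digits.\<close>

lemma card_nonzero_digits:
  assumes "b \<ge> 1" "I \<subseteq> {..<n}"
  shows "real (card {r\<in>{..<b ^ n}. \<forall>i\<in>I. \<not> b dvd r div b ^ (n - 1 - i)}) / real (b ^ n)
    = (1 - 1 / real b) ^ card I"
  using assms(2)
proof (induction n arbitrary: I)
  case 0
  then show ?case by (auto simp: Collect_conv_if)
next
  case (Suc n)
  define J where "J = I \<inter> {..<n}"
  define A where "A = {r\<in>{..<b ^ n}. \<forall>i\<in>J. \<not> b dvd r div b ^ (n - 1 - i)}"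
  define E where "E = {d\<in>{..<b}. n \<in> I \<longrightarrow> d \<noteq> 0}"
  have b: "b > 0" using assms by simp
  have I: "I = (if n \<in> I then insert n J else J)" "n \<notin> J" "finite J"
    using Suc.prems by (auto simp: J_def lessThan_Suc)
  have fin: "finite J" by (simp add: J_def)
  have "bij_betw (\<lambda>(q, d). q * b + d) (A \<times> E)
      {r\<in>{..<b ^ Suc n}. \<forall>i\<in>I. \<not> b dvd r div b ^ (Suc n - 1 - i)}" (is "bij_betw _ _ ?S")
  proof (rule bij_betw_byWitness[where f' = "\<lambda>r. (r div b, r mod b)"])
    have cond: "(\<forall>i\<in>I. \<not> b dvd r div b ^ (Suc n - 1 - i)) \<longleftrightarrow>
        (\<forall>i\<in>J. \<not> b dvd (r div b) div b ^ (n - 1 - i)) \<and> (n \<in> I \<longrightarrow> r mod b \<noteq> 0)" for r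
    proof -
      have "r div b ^ (Suc n - 1 - i) = (r div b) div b ^ (n - 1 - i)" if "i \<in> J" for i
      proof -
        have "Suc n - 1 - i = Suc (n - 1 - i)" using that by (auto simp: J_def)
        then show ?thesis by (simp add: div_mult2_eq)
      qed
      moreover have "(\<forall>i\<in>I. Q i) \<longleftrightarrow> (\<forall>i\<in>J. Q i) \<and> (n \<in> I \<longrightarrow> Q n)" for Q
        using I(1) by (metis insert_iff)
      ultimately show ?thesis by (auto simp: dvd_eq_mod_eq_0)
    qed
    show "(\<lambda>(q, d). q * b + d) ` (A \<times> E) \<subseteq> ?S"
    proof
      fix z assume "z \<in> (\<lambda>(q, d). q * b + d) ` (A \<times> E)"
      then obtain q d where z: "z = q * b + d" and "q \<in> A" "d \<in> E" by auto
      then have qd: "q < b ^ n" "d < b" "\<forall>i\<in>J. \<not> b dvd q div b ^ (n - 1 - i)" "n \<in> I \<longrightarrow> d \<noteq> 0"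
        by (auto simp: A_def E_def)
      have "q * b + d < (q + 1) * b" using qd by (simp add: algebra_simps)
      also have "\<dots> \<le> b ^ n * b" using qd by (intro mult_right_mono) auto
      finally have "q * b + d < b ^ Suc n" by (simp add: mult.commute)
      moreover have "(q * b + d) div b = q" "(q * b + d) mod b = d" using qd by auto
      ultimately show "z \<in> ?S"
        unfolding z mem_Collect_eq cond using qd by simp
    qed
    show "(\<lambda>r. (r div b, r mod b)) ` ?S \<subseteq> A \<times> E"
    proof
      fix z assume "z \<in> (\<lambda>r. (r div b, r mod b)) ` ?S"
      then obtain r where r: "r \<in> ?S" "z = (r div b, r mod b)" by blast
      have "r div b < b ^ n" using r b by (simp add: div_less_iff_less_mult mult.commute)
      then show "z \<in> A \<times> E"
        using r b unfolding mem_Collect_eq cond by (auto simp: A_def E_def)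
    qed
  qed (auto simp: E_def)
  then have "card ?S = card A * card E"
    by (simp add: bij_betw_same_card[symmetric] card_cartesian_product)
  then have "real (card ?S) / real (b ^ Suc n) = (real (card A) / real (b ^ n)) * (real (card E) / real b)"
    by simp
  also have "real (card A) / real (b ^ n) = (1 - 1 / real b) ^ card J"
    unfolding A_def by (rule Suc.IH) (simp add: J_def)
  also have "real (card E) / real b = (if n \<in> I then 1 - 1 / real b else 1)"
  proof -
    have "E = (if n \<in> I then {1..<b} else {..<b})" by (auto simp: E_def)
    then show ?thesis using b by (auto simp: of_nat_diff field_simps)
  qed
  also have "(1 - 1 / real b) ^ card J * (if n \<in> I then 1 - 1 / real b else 1) = (1 - 1 / real b) ^ card I"
  proof (cases "n \<in> I")
    case True
    then have "card I = Suc (card J)"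
      using I by (metis card_insert_disjoint)
    then show ?thesis using True by simp
  next
    case False
    then have "I = J" using I(1) by simp
    then show ?thesis using False by simp
  qed
  finally show ?case .
qed

lemma measure_nonzero_digits:
  assumes "b \<ge> 1" "finite I"
  shows "measure circle_measure {x \<in> {0..<1}. \<forall>i\<in>I. x \<notin> zero_digit b i} = (1 - 1 / real b) ^ card I"
proof -
  obtain n where n: "I \<subseteq> {..<n}" using assms(2) finite_nat_bounded by blast
  let ?R = "{r\<in>{..<b ^ n}. \<forall>i\<in>I. \<not> b dvd r div b ^ (n - 1 - i)}"
  have eq: "{x \<in> {0..<1}. \<forall>i\<in>I. x \<notin> zero_digit b i} = {x \<in> {0..<1}. nat \<lfloor>real (b ^ n) * x\<rfloor> \<in> ?R}"
  proof (intro Collect_cong conj_cong refl)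
    fix x :: real assume x: "x \<in> {0..<1}"
    have "nat \<lfloor>real (b ^ n) * x\<rfloor> < b ^ n"
      using x assms by (intro nat_floor_grid_less) auto
    moreover have "x \<in> zero_digit b i \<longleftrightarrow> b dvd nat \<lfloor>real (b ^ n) * x\<rfloor> div b ^ (n - 1 - i)" if "i \<in> I" for i
      using that n x assms by (intro zero_digit_iff_grid) auto
    ultimately show "(\<forall>i\<in>I. x \<notin> zero_digit b i) \<longleftrightarrow> nat \<lfloor>real (b ^ n) * x\<rfloor> \<in> ?R" by auto
  qed
  have "measure circle_measure {x \<in> {0..<1}. \<forall>i\<in>I. x \<notin> zero_digit b i} = real (card ?R) / real (b ^ n)"
    unfolding eq by (rule measure_grid_set) auto
  also have "\<dots> = (1 - 1 / real b) ^ card I"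
    using assms n by (intro card_nonzero_digits) auto
  finally show ?thesis .
qed

section \<open>The sum of the spikes\<close>

text \<open>
  Stage \<open>k\<close> owns the dyadic blocks \<open>2\<^sup>t \<le> j < 2\<^bsup>t + 1\<^esup>\<close> with \<open>4\<^sup>k \<le> t < 4\<^bsup>k + 1\<^esup>\<close>; \<open>stage_length k\<close> is twice the
  largest bound on \<open>j\<close> in these blocks.
\<close>
definition stage_length :: "nat \<Rightarrow> nat" where
  "stage_length k = 2 ^ (4 ^ (k + 1) + 1)"

definition stage_base :: "nat \<Rightarrow> nat" where
  "stage_base k = 2 ^ k * stage_length k"

definition spike_set :: "nat \<Rightarrow> real set" where
  "spike_set k = (\<Union>i<stage_length k. zero_digit (stage_base k) i)"

definition spike_prob :: "nat \<Rightarrow> real" where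
  "spike_prob k = (LINT x|circle_measure. indicator (spike_set k) x)"

definition spike :: "nat \<Rightarrow> real \<Rightarrow> real" where
  "spike k x = real k * (indicator (spike_set k) x - spike_prob k)"

text \<open>\<open>spike_tail 0\<close> is the function of the theorem. Points where the series
  diverges carry an unspecified value of \<open>suminf\<close>; \<open>AE_finite_spikes\<close>
  confines them to a null set.\<close>

definition spike_tail :: "nat \<Rightarrow> real \<Rightarrow> real" where
  "spike_tail K x = (\<Sum>k. spike (k + K) x)"

section \<open>Elementary properties and probabilities of the spikes\<close>

lemma stage_length_gt: "stage_length k > k"
proof -
  have "k < 2 ^ k" by (rule less_exp)
  also have "\<dots> \<le> 2 ^ (4 ^ (k + 1) + 1)"
  proof (rule power_increasing)
    have "k < 4 ^ k" by (rule order.strict_trans1[OF _ power_gt_expt]) auto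
    then show "k \<le> 4 ^ (k + 1) + 1" by simp
  qed simp
  finally show ?thesis by (simp add: stage_length_def)
qed

lemma stage_length_mono: "k \<le> l \<Longrightarrow> stage_length k \<le> stage_length l"
  unfolding stage_length_def by (intro power_increasing add_mono) auto

lemma stage_base_mono: "k \<le> l \<Longrightarrow> stage_base k \<le> stage_base l"
  unfolding stage_base_def by (intro mult_mono stage_length_mono power_increasing) auto

lemma stage_base_ge: "stage_base k \<ge> 2"
proof -
  have "2 ^ 1 \<le> (2 :: nat) ^ (4 ^ (k + 1) + 1)" by (intro power_increasing) auto
  then have "1 * 2 \<le> 2 ^ k * stage_length k"
    by (intro mult_mono) (auto simp: stage_length_def)
  then show ?thesis by (simp add: stage_base_def)
qed

lemma spike_set_borel [measurable]: "spike_set k \<in> sets borel"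
  unfolding spike_set_def by measurable

lemma spike_measurable [measurable]: "spike k \<in> borel_measurable borel"
  unfolding spike_def by measurable

lemma spike_tail_measurable [measurable]: "spike_tail K \<in> borel_measurable borel"
  unfolding spike_tail_def by measurable

lemma spike_set_add_1: "x + 1 \<in> spike_set k \<longleftrightarrow> x \<in> spike_set k"
  by (simp add: spike_set_def zero_digit_add_1)

lemma spike_tail_add_1: "spike_tail K (x + 1) = spike_tail K x"
  by (simp add: spike_tail_def spike_def indicator_def spike_set_add_1)

lemma spike_prob_eq_measure: "spike_prob k = measure circle_measure {x \<in> {0..<1}. x \<in> spike_set k}"
proof -
  have "spike_prob k = (LINT x|circle_measure. indicator {x \<in> {0..<1}. x \<in> spike_set k} x)"
    unfolding spike_prob_def by (intro Bochner_Integration.integral_cong) (auto simp: indicator_def)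
  also have "\<dots> = measure circle_measure {x \<in> {0..<1}. x \<in> spike_set k}"
    by (subst Bochner_Integration.integral_indicator)
      (auto simp: sets_circle_borel Int_def intro: arg_cong[where f = "measure _"])
  finally show ?thesis .
qed

lemma spike_prob_eq_indicator: "measure circle_measure (spike_set k \<inter> {0..<1}) = spike_prob k"
  by (simp add: spike_prob_def)

lemma spike_prob_nonneg: "spike_prob k \<ge> 0"
  by (simp add: spike_prob_eq_measure)

lemma abs_spike_le: "\<bar>spike k x\<bar> \<le> real k * (indicator (spike_set k) x + spike_prob k)"
proof -
  have "\<bar>indicator (spike_set k) x - spike_prob k\<bar> \<le> indicator (spike_set k) x + spike_prob k"
    using spike_prob_nonneg[of k] by (auto simp: indicator_def)
  then show ?thesis unfolding spike_def abs_mult by (simp add: mult_left_mono)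
qed

text \<open>A point avoids the spike set when its first \<open>stage_length k\<close> digits are all
  nonzero. Bernoulli's inequality bounds the probability \<open>(1 - 1 / b) ^ H\<close> of this from
  below by \<open>1 - H / b\<close>, and \<open>H / b\<close> is \<open>(1 / 2) ^ k\<close> by the
  choice of the base.\<close>

lemma spike_prob_le: "spike_prob k \<le> (1 / 2) ^ k"
proof -
  let ?b = "stage_base k" and ?H = "stage_length k"
  have b: "real ?b \<ge> 1" using stage_base_ge[of k] by linarith
  have H: "real ?H > 0" using stage_length_gt[of k] by linarith
  have M: "measure circle_measure {x \<in> {0..<1}. \<forall>i\<in>{..<?H}. x \<notin> zero_digit ?b i} = (1 - 1 / real ?b) ^ ?H"
    using measure_nonzero_digits[of ?b "{..<?H}"] b by simp
  have E: "{x \<in> {0..<1}. x \<in> spike_set k}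
      = space circle_measure - {x \<in> {0..<1}. \<forall>i\<in>{..<?H}. x \<notin> zero_digit ?b i}"
    by (auto simp: spike_set_def)
  have S: "{x \<in> {0..<1}. \<forall>i\<in>{..<?H}. x \<notin> zero_digit ?b i} \<in> sets circle_measure"
  proof -
    have "{x \<in> {0..<1}. x \<in> - spike_set k} \<in> sets circle_measure"
      by (intro sets_circle_borel) measurable
    also have "{x \<in> {0..<1}. x \<in> - spike_set k} = {x \<in> {0..<1}. \<forall>i\<in>{..<?H}. x \<notin> zero_digit ?b i}"
      by (auto simp: spike_set_def)
    finally show ?thesis .
  qed
  have "spike_prob k = 1 - (1 - 1 / real ?b) ^ ?H"
    unfolding spike_prob_eq_measure E finite_measure.finite_measure_compl[OF finite_measure_circle S] M by simp
  moreover have "1 + real ?H * (- 1 / real ?b) \<le> (1 + - 1 / real ?b) ^ ?H"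
    using b by (intro Bernoulli_inequality) (auto simp: field_simps)
  moreover have "real ?H / real ?b = (1 / 2) ^ k"
    using H by (simp add: stage_base_def power_one_over)
  ultimately show ?thesis by simp
qed

section \<open>Geometric bounds and convergence of the spike series\<close>

lemma exponential_dominates_powr:
  fixes q :: real
  obtains D where "D > 0" "\<And>k. real (k + 1) powr q * (1 / 2) ^ k \<le> D * (3 / 4) ^ k"
proof -
  have "(\<lambda>k::nat. real (k + 1) powr q * (2 / 3) ^ k) \<longlonglongrightarrow> 0"
    by real_asymp
  then have "Bseq (\<lambda>k::nat. real (k + 1) powr q * (2 / 3) ^ k)"
    by (intro convergent_imp_Bseq convergentI)
  then obtain D where D: "D > 0" "\<And>k. norm (real (k + 1) powr q * (2 / 3) ^ k) \<le> D"
    by (auto simp: Bseq_def)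
  have "real (k + 1) powr q * (1 / 2) ^ k \<le> D * (3 / 4) ^ k" for k
  proof -
    \<comment> \<open>The factor \<open>(2 / 3) ^ k\<close> absorbs the power of
      \<open>k + 1\<close>, and \<open>(3 / 4) ^ k\<close> is the decay that is kept.\<close>
    have "(1 / 2 :: real) ^ k = (2 / 3) ^ k * (3 / 4) ^ k"
      by (simp flip: power_mult_distrib)
    then have "real (k + 1) powr q * (1 / 2) ^ k = (real (k + 1) powr q * (2 / 3) ^ k) * (3 / 4) ^ k"
      by simp
    also have "\<dots> \<le> D * (3 / 4) ^ k"
      using D(2)[of k] by (intro mult_right_mono) auto
    finally show ?thesis .
  qed
  then show ?thesis using D(1) that by blast
qed

lemma suminf_geometric_tail:
  fixes a :: "nat \<Rightarrow> real"
  assumes "\<And>k. 0 \<le> a k" "\<And>k. a k \<le> D * (3 / 4) ^ k"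
  shows "summable a" "(\<Sum>k. a (k + K)) \<le> 4 * D * (3 / 4) ^ K"
proof -
  have *: "(\<lambda>k. D * (3 / 4) ^ (k + K)) sums (4 * D * (3 / 4) ^ K)" for K
    using sums_mult[OF geometric_sums[of "3 / 4 :: real"], of "D * (3 / 4) ^ K"]
    by (simp add: power_add mult_ac)
  show s: "summable a"
  proof (rule summable_comparison_test')
    show "summable (\<lambda>k. D * (3 / 4) ^ (k + 0))" by (rule sums_summable[OF *])
    show "norm (a k) \<le> D * (3 / 4) ^ (k + 0)" if "k \<ge> 0" for k
      using assms[of k] by simp
  qed
  show "(\<Sum>k. a (k + K)) \<le> 4 * D * (3 / 4) ^ K"
  proof -
    have "(\<Sum>k. a (k + K)) \<le> (\<Sum>k. D * (3 / 4) ^ (k + K))"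
      by (rule suminf_le[OF assms(2) summable_ignore_initial_segment[OF s] sums_summable[OF *]])
    then show ?thesis using sums_unique[OF *, of K] by simp
  qed
qed

text \<open>The total mean of the uncentred spikes from stage \<open>K\<close> on. Its negative is
  the value of \<open>spike_tail K\<close> at points where none of these spikes is active.\<close>

definition spike_mean :: "nat \<Rightarrow> real" where
  "spike_mean K = (\<Sum>k. real (k + K) * spike_prob (k + K))"

lemma spike_mean_bound:
  obtains D where "D > 0" "\<And>k. real k * spike_prob k \<le> D * (3 / 4) ^ k"
proof -
  obtain D where D: "D > 0" "\<And>k. real (k + 1) powr 1 * (1 / 2) ^ k \<le> D * (3 / 4) ^ k"
    using exponential_dominates_powr[of 1] by blast
  have "real k * spike_prob k \<le> D * (3 / 4) ^ k" for k
  proof -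
    have "real k * spike_prob k \<le> real (k + 1) * (1 / 2) ^ k"
      by (intro mult_mono spike_prob_le spike_prob_nonneg) auto
    then show ?thesis using D(2)[of k] by simp
  qed
  then show ?thesis using D(1) that by blast
qed

lemma summable_spike_mean: "summable (\<lambda>k. real k * spike_prob k)"
proof -
  obtain D where "D > 0" "\<And>k. real k * spike_prob k \<le> D * (3 / 4) ^ k"
    using spike_mean_bound by blast
  then show ?thesis by (intro suminf_geometric_tail) (auto simp: spike_prob_nonneg)
qed

lemma summable_spike_mean_shift: "summable (\<lambda>k. real (k + K) * spike_prob (k + K))"
  by (rule summable_ignore_initial_segment[OF summable_spike_mean])

lemma spike_mean_nonneg: "spike_mean K \<ge> 0"
  unfolding spike_mean_def by (intro suminf_nonneg summable_spike_mean_shift) (simp add: spike_prob_nonneg)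

lemma spike_mean_le: "spike_mean K \<le> spike_mean 0"
proof -
  have "spike_mean 0 = spike_mean K + (\<Sum>k<K. real k * spike_prob k)"
    unfolding spike_mean_def using suminf_split_initial_segment[OF summable_spike_mean, of K] by simp
  then show ?thesis by (simp add: sum_nonneg spike_prob_nonneg)
qed

text \<open>The probabilities are dominated by a geometric series, so the first Borel-Cantelli lemma
  applies.\<close>

lemma AE_finite_spikes: "AE x in circle_measure. finite {k. x \<in> spike_set k}"
proof -
  have "AE x in circle_measure. eventually (\<lambda>k. x \<in> space circle_measure - {x \<in> {0..<1}. x \<in> spike_set k}) sequentially"
  proof (rule borel_cantelli_AE1)
    show "{x \<in> {0..<1}. x \<in> spike_set k} \<in> sets circle_measure" for k
      by (intro sets_circle_borel) measurable
    show "emeasure circle_measure {x \<in> {0..<1}. x \<in> spike_set k} < \<infinity>" for k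
      using finite_measure.emeasure_finite[OF finite_measure_circle] by (simp add: less_top)
    show "summable (\<lambda>k. measure circle_measure {x \<in> {0..<1}. x \<in> spike_set k})"
      unfolding spike_prob_eq_measure[symmetric]
    proof (rule summable_comparison_test')
      show "summable (\<lambda>k. (1 / 2 :: real) ^ k)" by (rule summable_geometric) simp
      show "norm (spike_prob k) \<le> (1 / 2) ^ k" if "k \<ge> 0" for k
        using spike_prob_nonneg[of k] spike_prob_le[of k] by simp
    qed
  qed
  then show ?thesis
  proof eventually_elim
    case (elim x)
    then obtain k0 where "\<And>k. k \<ge> k0 \<Longrightarrow> x \<in> space circle_measure - {x \<in> {0..<1}. x \<in> spike_set k}"
      by (auto simp: eventually_sequentially)
    then have "{k. x \<in> spike_set k} \<subseteq> {..<k0}" by (force simp: not_le[symmetric])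
    then show ?case by (rule finite_subset) simp
  qed
qed

lemma spike_sums:
  assumes "finite {k. x \<in> spike_set k}"
  shows "(\<lambda>k. spike (k + K) x) sums ((\<Sum>k | x \<in> spike_set (k + K). real (k + K)) - spike_mean K)"
proof -
  have "finite ((\<lambda>k. k + K) -` {k. x \<in> spike_set k})"
    using assms by (intro finite_vimageI) auto
  then have fin: "finite {k. x \<in> spike_set (k + K)}" by (simp add: vimage_def)
  have "(\<lambda>k. if k \<in> {k. x \<in> spike_set (k + K)} then real (k + K) else 0)
      sums (\<Sum>k | x \<in> spike_set (k + K). real (k + K))"
    by (rule sums_If_finite_set[OF fin])
  moreover have "(\<lambda>k. real (k + K) * spike_prob (k + K)) sums spike_mean K"
    unfolding spike_mean_def by (intro summable_sums summable_spike_mean_shift)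
  ultimately have "(\<lambda>k. (if k \<in> {k. x \<in> spike_set (k + K)} then real (k + K) else 0)
      - real (k + K) * spike_prob (k + K)) sums ((\<Sum>k | x \<in> spike_set (k + K). real (k + K)) - spike_mean K)"
    by (rule sums_diff)
  moreover have "(\<lambda>k. (if k \<in> {k. x \<in> spike_set (k + K)} then real (k + K) else 0)
      - real (k + K) * spike_prob (k + K)) = (\<lambda>k. spike (k + K) x)"
    by (auto simp: spike_def indicator_def algebra_simps)
  ultimately show ?thesis by simp
qed

lemma spike_tail_eq:
  assumes "finite {k. x \<in> spike_set k}"
  shows "spike_tail K x = (\<Sum>k | x \<in> spike_set (k + K). real (k + K)) - spike_mean K"
  using spike_sums[OF assms] unfolding spike_tail_def by (simp add: sums_iff)

lemma spike_tail_split: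
  assumes "finite {k. x \<in> spike_set k}"
  shows "spike_tail 0 x = (\<Sum>k<K. spike k x) + spike_tail K x"
proof -
  have "summable (\<lambda>k. spike k x)" using spike_sums[OF assms, of 0] by (simp add: sums_iff)
  from suminf_split_initial_segment[OF this, of K] show ?thesis
    by (simp add: spike_tail_def)
qed

text \<open>Before centring all spikes are nonnegative, so every active spike except the one under
  consideration can be discarded.\<close>

lemma spike_tail_lower_bound:
  assumes "finite {k. x \<in> spike_set k}"
  shows "spike_tail 0 x \<ge> real k * indicator (spike_set k) x - spike_mean 0"
proof -
  have "real k * indicator (spike_set k) x \<le> (\<Sum>k | x \<in> spike_set k. real k)"
  proof (cases "x \<in> spike_set k")
    case True
    then have "real k \<le> (\<Sum>k | x \<in> spike_set k. real k)"
      using assms by (intro member_le_sum[of k]) auto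
    then show ?thesis using True by simp
  qed (simp add: sum_nonneg)
  then show ?thesis using spike_tail_eq[OF assms, of 0] by simp
qed

text \<open>The \<open>p\<close>-th power of a bound for the whole sum when \<open>k\<close> is the
  last active stage: at most \<open>k + 1\<close> spikes of height at most \<open>k\<close> are then
  active, and the means add at most \<open>spike_mean 0\<close>.\<close>

definition spike_weight :: "real \<Rightarrow> nat \<Rightarrow> real" where
  "spike_weight p k = ((1 + spike_mean 0) * (real (k + 1))\<^sup>2) powr p"

text \<open>Where some spike is active, the last active one controls the whole sum.\<close>
lemma abs_spike_tail_powr_le:
  assumes fin: "finite {k. x \<in> spike_set k}" and p: "p > 0"
  shows "\<bar>spike_tail K x\<bar> powr p
    \<le> spike_mean K powr p + (\<Sum>k. spike_weight p (k + K) * indicator (spike_set (k + K)) x)"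
    and "summable (\<lambda>k. spike_weight p (k + K) * indicator (spike_set (k + K)) x)"
proof -
  define T where "T = {k. x \<in> spike_set (k + K)}"
  have "finite ((\<lambda>k. k + K) -` {k. x \<in> spike_set k})"
    using fin by (intro finite_vimageI) auto
  then have T: "finite T" by (simp add: T_def vimage_def)
  have w: "spike_weight p k \<ge> 0" for k by (simp add: spike_weight_def)
  show "summable (\<lambda>k. spike_weight p (k + K) * indicator (spike_set (k + K)) x)"
    by (rule summable_finite[OF T]) (auto simp: T_def)
  have sum_eq: "(\<Sum>k. spike_weight p (k + K) * indicator (spike_set (k + K)) x)
      = (\<Sum>k\<in>T. spike_weight p (k + K))"
    by (subst suminf_finite[OF T]) (auto simp: T_def intro: sum.cong)
  have tail: "spike_tail K x = (\<Sum>k\<in>T. real (k + K)) - spike_mean K"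
    using spike_tail_eq[OF fin] by (simp add: T_def)
  show "\<bar>spike_tail K x\<bar> powr p
    \<le> spike_mean K powr p + (\<Sum>k. spike_weight p (k + K) * indicator (spike_set (k + K)) x)"
  proof (cases "T = {}")
    case True
    then show ?thesis unfolding sum_eq using tail spike_mean_nonneg[of K] by simp
  next
    case False
    define m where "m = Max T"
    have m: "m \<in> T" "T \<subseteq> {..m}" using T False by (auto simp: m_def)
    have "(\<Sum>k\<in>T. real (k + K)) \<le> (\<Sum>k\<in>{..m}. real (m + K))"
      using m by (intro order_trans[OF sum_mono2[of "{..m}"] sum_mono]) auto
    also have "\<dots> = real (m + 1) * real (m + K)" by simp
    also have "\<dots> \<le> real (m + K + 1) * real (m + K + 1)" by (intro mult_mono) auto
    finally have s: "(\<Sum>k\<in>T. real (k + K)) \<le> (real (m + K + 1))\<^sup>2" by (simp add: power2_eq_square)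
    have "1 \<le> (real (m + K + 1))\<^sup>2" by (intro one_le_power) simp
    then have "spike_mean 0 * 1 \<le> spike_mean 0 * (real (m + K + 1))\<^sup>2"
      by (intro mult_left_mono spike_mean_nonneg)
    moreover have "0 \<le> (\<Sum>k\<in>T. real (k + K))" by (intro sum_nonneg) auto
    ultimately have "\<bar>spike_tail K x\<bar> \<le> (1 + spike_mean 0) * (real (m + K + 1))\<^sup>2"
      using tail s spike_mean_nonneg[of K] spike_mean_le[of K] by (simp add: algebra_simps)
    then have "\<bar>spike_tail K x\<bar> powr p \<le> spike_weight p (m + K)"
      unfolding spike_weight_def using p by (intro powr_mono2) auto
    also have "\<dots> \<le> (\<Sum>k\<in>T. spike_weight p (k + K))"
      using m T w by (intro member_le_sum) auto
    finally show ?thesis unfolding sum_eq by (simp add: add_increasing)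
  qed
qed

lemma spike_weight_bound:
  assumes "p > 0"
  obtains D where "D > 0" "\<And>k. spike_weight p k * spike_prob k \<le> D * (3 / 4) ^ k"
proof -
  obtain D where D: "D > 0" "\<And>k. real (k + 1) powr (2 * p) * (1 / 2) ^ k \<le> D * (3 / 4) ^ k"
    using exponential_dominates_powr by blast
  define A where "A = (1 + spike_mean 0) powr p"
  have A: "A > 0" using spike_mean_nonneg[of 0] by (simp add: A_def)
  have "spike_weight p k * spike_prob k \<le> (A * D) * (3 / 4) ^ k" for k
  proof -
    have "(real (k + 1))\<^sup>2 powr p = real (k + 1) powr (2 * p)"
      by (subst powr_numeral[symmetric]) (auto simp: powr_powr simp del: powr_numeral)
    then have "spike_weight p k = A * real (k + 1) powr (2 * p)"
      unfolding spike_weight_def A_def using spike_mean_nonneg[of 0] by (subst powr_mult) auto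
    then have "spike_weight p k * spike_prob k \<le> A * (real (k + 1) powr (2 * p) * (1 / 2) ^ k)"
      using A spike_prob_le[of k] by (simp add: mult_left_mono mult.assoc)
    also have "\<dots> \<le> A * (D * (3 / 4) ^ k)"
      using A D(2) by (intro mult_left_mono) auto
    finally show ?thesis by simp
  qed
  then show ?thesis using A D(1) that[of "A * D"] by simp
qed

lemma integrable_circle_indicator:
  "integrable circle_measure (\<lambda>x. c * indicator (spike_set k) x :: real)"
proof (rule integrable_circle_bounded[where B = "\<bar>c\<bar>"])
  show "(\<lambda>x. c * indicator (spike_set k) x) \<in> borel_measurable circle_measure"
    by (intro measurable_circle) measurable
qed (auto simp: indicator_def)

text \<open>The pointwise domination is integrated term by term; the resulting series converges
  because the weights grow polynomially while the probabilities decay exponentially. All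
  \<open>p\<close> give the integrability of \<open>f\<close>, and \<open>p = 2\<close> gives the
  size of its tails.\<close>

lemma spike_tail_powr_integral:
  assumes p: "p > 0"
  shows "integrable circle_measure (\<lambda>x. \<bar>spike_tail K x\<bar> powr p)"
    and "(LINT x|circle_measure. \<bar>spike_tail K x\<bar> powr p)
      \<le> spike_mean K powr p + (\<Sum>k. spike_weight p (k + K) * spike_prob (k + K))"
proof -
  let ?h = "\<lambda>k x. spike_weight p (k + K) * indicator (spike_set (k + K)) x"
  let ?R = "\<lambda>x. spike_mean K powr p + (\<Sum>k. ?h k x)"
  obtain D where D: "D > 0" "\<And>k. spike_weight p k * spike_prob k \<le> D * (3 / 4) ^ k"
    using spike_weight_bound[OF p] by blast
  have w: "spike_weight p k \<ge> 0" for k by (simp add: spike_weight_def)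
  have I: "(LINT x|circle_measure. ?h k x) = spike_weight p (k + K) * spike_prob (k + K)" for k
    by (simp add: spike_prob_def)
  have sm: "summable (\<lambda>k. spike_weight p k * spike_prob k)"
    using D by (intro suminf_geometric_tail[where D = D]) (auto intro!: mult_nonneg_nonneg w spike_prob_nonneg)
  have norm_h: "norm (?h k x) = ?h k x" for k x using w by (simp add: abs_mult)
  have int_h: "integrable circle_measure (?h k)" for k by (rule integrable_circle_indicator)
  have AE_sum: "AE x in circle_measure. summable (\<lambda>k. norm (?h k x))"
    using AE_finite_spikes by eventually_elim (use abs_spike_tail_powr_le(2)[OF _ p] norm_h in simp)
  have sum_int: "summable (\<lambda>k. LINT x|circle_measure. norm (?h k x))"
    unfolding norm_h I by (rule summable_ignore_initial_segment[OF sm])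
  have int_S: "integrable circle_measure (\<lambda>x. \<Sum>k. ?h k x)"
    by (rule integrable_suminf[OF int_h AE_sum sum_int])
  have int_R: "integrable circle_measure ?R"
    by (intro Bochner_Integration.integrable_add int_S integrable_circle_bounded[where B = "spike_mean K powr p"]) auto
  have le: "AE x in circle_measure. \<bar>spike_tail K x\<bar> powr p \<le> ?R x"
    using AE_finite_spikes by eventually_elim (rule abs_spike_tail_powr_le(1)[OF _ p])
  show int: "integrable circle_measure (\<lambda>x. \<bar>spike_tail K x\<bar> powr p)"
  proof (rule Bochner_Integration.integrable_bound[OF int_R])
    show "(\<lambda>x. \<bar>spike_tail K x\<bar> powr p) \<in> borel_measurable circle_measure"
      by (intro measurable_circle) measurable
    show "AE x in circle_measure. norm (\<bar>spike_tail K x\<bar> powr p) \<le> norm (?R x)"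
      using le by eventually_elim auto
  qed
  have "(LINT x|circle_measure. \<bar>spike_tail K x\<bar> powr p) \<le> (LINT x|circle_measure. ?R x)"
    by (rule integral_mono_AE[OF int int_R le])
  also have "\<dots> = (LINT x|circle_measure. spike_mean K powr p) + (LINT x|circle_measure. (\<Sum>k. ?h k x))"
    by (intro Bochner_Integration.integral_add int_S integrable_circle_bounded[where B = "spike_mean K powr p"]) auto
  also have "(LINT x|circle_measure. (\<Sum>k. ?h k x)) = (\<Sum>k. LINT x|circle_measure. ?h k x)"
    by (rule integral_suminf[OF int_h AE_sum sum_int])
  finally show "(LINT x|circle_measure. \<bar>spike_tail K x\<bar> powr p)
      \<le> spike_mean K powr p + (\<Sum>k. spike_weight p (k + K) * spike_prob (k + K))"
    unfolding I by simp
qed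

lemma spike_tail_Lp: "p \<ge> 1 \<Longrightarrow> spike_tail 0 \<in> Lp_circle p"
  unfolding Lp_circle_def
  using spike_tail_powr_integral(1)[of p 0] by (auto simp: spike_tail_add_1 intro: measurable_circle)

text \<open>With exponent 2, both the squared mean of the tail and the tail of the weighted series
  decay geometrically in \<open>K\<close>.\<close>

lemma spike_tail_sq_integral:
  obtains D where "D > 0" "\<And>K. (LINT x|circle_measure. (spike_tail K x)\<^sup>2) \<le> D * (3 / 4) ^ K"
proof -
  obtain D1 where D1: "D1 > 0" "\<And>k. real k * spike_prob k \<le> D1 * (3 / 4) ^ k"
    using spike_mean_bound by blast
  obtain D2 where D2: "D2 > 0" "\<And>k. spike_weight 2 k * spike_prob k \<le> D2 * (3 / 4) ^ k"
    using spike_weight_bound[of 2] by auto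
  have "(LINT x|circle_measure. (spike_tail K x)\<^sup>2) \<le> (16 * D1\<^sup>2 + 4 * D2) * (3 / 4) ^ K" for K
  proof -
    have "spike_mean K \<le> 4 * D1 * (3 / 4) ^ K"
      unfolding spike_mean_def using D1 by (intro suminf_geometric_tail) (auto simp: spike_prob_nonneg)
    then have "(spike_mean K)\<^sup>2 \<le> (4 * D1 * (3 / 4) ^ K)\<^sup>2"
      by (intro power_mono spike_mean_nonneg)
    also have "\<dots> = 16 * D1\<^sup>2 * ((3 / 4) ^ K * (3 / 4) ^ K)"
      by (simp add: power2_eq_square)
    also have "\<dots> \<le> 16 * D1\<^sup>2 * ((3 / 4) ^ K * 1)"
      by (intro mult_left_mono power_le_one) auto
    finally have 1: "(spike_mean K)\<^sup>2 \<le> 16 * D1\<^sup>2 * (3 / 4) ^ K" by simp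
    have 2: "(\<Sum>k. spike_weight 2 (k + K) * spike_prob (k + K)) \<le> 4 * D2 * (3 / 4) ^ K"
      by (rule suminf_geometric_tail(2)[of "\<lambda>k. spike_weight 2 k * spike_prob k", OF _ D2(2)])
        (simp add: spike_weight_def spike_prob_nonneg)
    have "(LINT x|circle_measure. (spike_tail K x)\<^sup>2) = (LINT x|circle_measure. \<bar>spike_tail K x\<bar> powr 2)"
      by simp
    also have "\<dots> \<le> (spike_mean K) powr 2 + (\<Sum>k. spike_weight 2 (k + K) * spike_prob (k + K))"
      by (intro spike_tail_powr_integral) auto
    also have "(spike_mean K) powr 2 = (spike_mean K)\<^sup>2"
      using spike_mean_nonneg by simp
    finally show ?thesis using 1 2 by (simp add: ring_distribs)
  qed
  moreover have "16 * D1\<^sup>2 + 4 * D2 > 0" using D2(1) by (simp add: add_nonneg_pos)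
  ultimately show ?thesis using that by blast
qed

text \<open>Each spike is centred. Sum and integral may be interchanged because the
  \<open>L^1\<close> norms are at most \<open>2 * (real k * spike_prob k)\<close>, which is
  summable.\<close>

lemma spike_tail_integral_0: "(LINT x|circle_measure. spike_tail 0 x) = 0"
proof -
  have int: "integrable circle_measure (spike k)" for k
  proof (rule integrable_circle_bounded)
    show "norm (spike k x) \<le> real k * (1 + spike_prob k)" if "x \<in> {0..<1}" for x
    proof -
      have "real k * (indicator (spike_set k) x + spike_prob k) \<le> real k * (1 + spike_prob k)"
        by (intro mult_left_mono) (auto simp: indicator_def)
      then show ?thesis using abs_spike_le[of k x] by simp
    qed
  qed (intro measurable_circle spike_measurable)
  have int_abs: "integrable circle_measure (\<lambda>x. real k * (indicator (spike_set k) x + spike_prob k))" for k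
    by (rule integrable_circle_bounded[where B = "real k * (1 + spike_prob k)"])
      (auto simp: abs_mult indicator_def spike_prob_nonneg intro!: measurable_circle mult_left_mono)
  have "AE x in circle_measure. summable (\<lambda>k. norm (spike k x))"
    using AE_finite_spikes
  proof eventually_elim
    case (elim x)
    have "summable (\<lambda>k. real k * indicator (spike_set k) x + real k * spike_prob k)"
      by (intro summable_add summable_spike_mean summable_finite[OF elim]) auto
    then show ?case
      by (rule summable_comparison_test'[where N = 0]) (use abs_spike_le in \<open>simp add: ring_distribs\<close>)
  qed
  moreover have "summable (\<lambda>k. LINT x|circle_measure. norm (spike k x))"
  proof (rule summable_comparison_test[where g = "\<lambda>k. 2 * (real k * spike_prob k)"])
    have "(LINT x|circle_measure. norm (spike k x)) \<le> 2 * (real k * spike_prob k)" for k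
    proof -
      have "(LINT x|circle_measure. norm (spike k x))
          \<le> (LINT x|circle_measure. real k * (indicator (spike_set k) x + spike_prob k))"
        using abs_spike_le by (intro integral_mono integrable_norm int int_abs) simp
      also have "\<dots> = real k * (spike_prob k + spike_prob k)"
        using integrable_circle_indicator[of 1 k] integrable_circle_bounded[of "\<lambda>_. spike_prob k" "spike_prob k"]
          spike_prob_eq_indicator
        by (simp add: spike_prob_nonneg)
      finally show ?thesis by simp
    qed
    then show "\<exists>N. \<forall>k\<ge>N. norm (LINT x|circle_measure. norm (spike k x)) \<le> 2 * (real k * spike_prob k)"
      by auto
    show "summable (\<lambda>k. 2 * (real k * spike_prob k))"
      by (intro summable_mult summable_spike_mean)
  qed
  ultimately have "(LINT x|circle_measure. (\<Sum>k. spike k x)) = (\<Sum>k. LINT x|circle_measure. spike k x)"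
    by (rule integral_suminf[OF int])
  moreover have "(LINT x|circle_measure. spike k x) = 0" for k
    using integrable_circle_indicator[of 1 k] integrable_circle_bounded[of "\<lambda>_. spike_prob k" "spike_prob k"]
      spike_prob_eq_indicator
    by (simp add: spike_def spike_prob_nonneg)
  ultimately show ?thesis by (simp add: spike_tail_def)
qed

section \<open>Decay of the Fourier tail\<close>

definition stage_grid :: "nat \<Rightarrow> nat" where
  "stage_grid k = stage_base k ^ stage_length k"

lemma stage_grid_mono: "k \<le> l \<Longrightarrow> stage_grid k \<le> stage_grid l"
  unfolding stage_grid_def using stage_base_ge[of l]
  by (intro order_trans[OF power_mono[OF stage_base_mono] power_increasing[OF stage_length_mono]]) auto

text \<open>The first bound gives \<open>K^2 / stage_grid K\<close> at most
  \<open>(1 / 2) ^ K\<close>, which absorbs the polynomial losses in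
  \<open>spike_partial_sum_dist\<close>.\<close>

lemma stage_grid_ge: "2 ^ k * k\<^sup>2 \<le> stage_grid k" "stage_grid k \<ge> 1"
proof -
  have "2 ^ 1 \<le> stage_length k" unfolding stage_length_def by (rule power_increasing) auto
  then have H: "2 \<le> stage_length k" by simp
  have "2 ^ k * k\<^sup>2 \<le> (2 ^ k)\<^sup>2 * (stage_length k)\<^sup>2"
    using stage_length_gt[of k] by (intro mult_mono power_mono) (auto simp: power2_eq_square)
  also have "\<dots> = stage_base k ^ 2" by (simp add: stage_base_def power_mult_distrib)
  also have "\<dots> \<le> stage_grid k"
    unfolding stage_grid_def using H stage_base_ge[of k] by (intro power_increasing) auto
  finally show "2 ^ k * k\<^sup>2 \<le> stage_grid k" .
  show "stage_grid k \<ge> 1" using stage_base_ge[of k] by (simp add: stage_grid_def)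
qed

text \<open>With \<open>A = 4 ^ (k + 1)\<close> the grid size is the power of 2 with exponent
  \<open>(k + A + 1) * 2 ^ (A + 1)\<close>, hence triply exponential in \<open>k\<close>. The fourth
  power is the threshold for \<open>N\<close> used below, and only changes constants.\<close>

lemma stage_grid_le:
  assumes "k \<ge> 1"
  shows "real (stage_grid k ^ 4) \<le> exp (exp (exp (6 * real k)))"
proof -
  define A :: nat where "A = 4 ^ (k + 1)"
  have A: "A \<ge> 4" unfolding A_def by simp
  have kA: "k < A"
  proof -
    have "k < 4 ^ k" by (rule order.strict_trans1[OF _ power_gt_expt]) auto
    then show ?thesis by (simp add: A_def)
  qed
  have two: "(2 :: real) ^ n \<le> exp (real n)" for n
  proof -
    have "(2 :: real) \<le> exp 1" using exp_ge_add_one_self[of 1] by simp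
    then have "(2 :: real) ^ n \<le> exp 1 ^ n" by (intro power_mono) auto
    then show ?thesis by (simp add: exp_of_nat_mult[symmetric])
  qed
  have "k + (A + 1) \<le> 2 * 2 ^ A" using kA less_exp[of A] by linarith
  then have "(k + (A + 1)) * 2 ^ (A + 1) * 4 \<le> (2 * 2 ^ A) * 2 ^ (A + 1) * 4"
    by (intro mult_right_mono) auto
  also have "\<dots> = 2 ^ (A + A + 4)" unfolding power_add by simp
  also have "\<dots> \<le> 2 ^ (3 * A)" using A by (intro power_increasing) linarith+
  finally have "(k + (A + 1)) * 2 ^ (A + 1) * 4 \<le> 2 ^ (3 * A)" .
  moreover have "stage_grid k ^ 4 = 2 ^ ((k + (A + 1)) * 2 ^ (A + 1) * 4)"
    unfolding stage_grid_def stage_base_def stage_length_def A_def[symmetric]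
    by (simp only: power_add[symmetric] power_mult[symmetric])
  ultimately have "stage_grid k ^ 4 \<le> 2 ^ (2 ^ (3 * A))" by (simp add: power_increasing)
  then have "real (stage_grid k ^ 4) \<le> real (2 ^ (2 ^ (3 * A)))" by (simp only: of_nat_le_iff)
  also have "\<dots> = 2 ^ (2 ^ (3 * A))" by (simp only: of_nat_power of_nat_numeral)
  also have "\<dots> \<le> exp (real (2 ^ (3 * A)))" by (rule two)
  also have "\<dots> \<le> exp (exp (real (3 * A)))" using two[of "3 * A"] by simp
  also have "\<dots> \<le> exp (exp (exp (6 * real k)))"
  proof -
    \<comment> \<open>The constant 6 arises here: 12 is at most \<open>2 ^ (4 * k)\<close> since
      \<open>k\<close> is at least 1.\<close>
    have "real (3 * A) = 12 * 2 ^ (2 * k)" by (simp add: A_def power_mult)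
    also have "\<dots> \<le> 2 ^ (4 * k) * 2 ^ (2 * k)"
    proof -
      have "(2 :: real) ^ 4 \<le> 2 ^ (4 * k)" using assms by (intro power_increasing) auto
      then show ?thesis by (intro mult_right_mono) auto
    qed
    also have "\<dots> = 2 ^ (6 * k)" by (simp add: power_add[symmetric])
    also have "\<dots> \<le> exp (real (6 * k))" by (rule two)
    finally show ?thesis by simp
  qed
  finally show ?thesis .
qed

text \<open>Membership in the spike set depends only on the first \<open>stage_length k\<close>
  digits, so on \<open>[0, 1)\<close> its indicator is a step function on the grid of
  \<open>stage_grid k\<close> cells.\<close>

lemma spike_trig_approximation:
  assumes N: "N \<ge> 1"
  obtains P where "P \<in> trig_polys N"
    "(LINT x|circle_measure. (cmod (of_bool (x \<in> spike_set k) - P x))\<^sup>2) \<le> 4 * (real (stage_grid k))\<^sup>2 / real N"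
proof -
  let ?b = "stage_base k" and ?H = "stage_length k" and ?M = "stage_grid k"
  let ?R = "{r\<in>{..<?M}. \<exists>i<?H. ?b dvd r div ?b ^ (?H - 1 - i)}"
  have grid: "x \<in> spike_set k \<longleftrightarrow> nat \<lfloor>real ?M * x\<rfloor> \<in> ?R" if x: "x \<in> {0..<1}" for x
  proof -
    have "nat \<lfloor>real ?M * x\<rfloor> < ?M" using x stage_grid_ge[of k] by (intro nat_floor_grid_less) auto
    moreover have "x \<in> zero_digit ?b i \<longleftrightarrow> ?b dvd nat \<lfloor>real ?M * x\<rfloor> div ?b ^ (?H - 1 - i)" if "i < ?H" for i
      unfolding stage_grid_def using that x stage_base_ge[of k] by (intro zero_digit_iff_grid) auto
    ultimately show ?thesis by (auto simp: spike_set_def)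
  qed
  obtain P where P: "P \<in> trig_polys N"
    "(LINT x|circle_measure. (cmod (of_bool (nat \<lfloor>real ?M * x\<rfloor> \<in> ?R) - P x))\<^sup>2) \<le> 4 * (real ?M)\<^sup>2 / real N"
    using step_function_trig_approximation[of ?M N ?R] N stage_grid_ge(2) by blast
  have "(LINT x|circle_measure. (cmod (of_bool (x \<in> spike_set k) - P x))\<^sup>2)
     = (LINT x|circle_measure. (cmod (of_bool (nat \<lfloor>real ?M * x\<rfloor> \<in> ?R) - P x))\<^sup>2)"
    by (intro Bochner_Integration.integral_cong refl) (simp only: space_circle_measure grid)
  then show ?thesis using P that by simp
qed

text \<open>Stages below \<open>K\<close> are approximated by trigonometric polynomials, and all
  later stages are counted as error. Once \<open>N\<close> reaches the fourth power of the grid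
  size, both errors are exponentially small in \<open>K\<close>.\<close>

lemma spike_partial_sum_dist:
  obtains D where "D > 0" "\<And>N K. N \<ge> stage_grid K ^ 4 \<Longrightarrow>
    (LINT x|circle_measure. (cmod (of_real (spike_tail 0 x) - fourier_partial_sum N (spike_tail 0) x))\<^sup>2)
      \<le> D * (3 / 4) ^ K"
proof -
  obtain D where D: "D > 0" "\<And>K. (LINT x|circle_measure. (spike_tail K x)\<^sup>2) \<le> D * (3 / 4) ^ K"
    using spike_tail_sq_integral by blast
  have int_tail: "integrable circle_measure (\<lambda>x. (spike_tail K x)\<^sup>2)" for K
    using spike_tail_powr_integral(1)[of 2 K] by simp
  have "(LINT x|circle_measure. (cmod (of_real (spike_tail 0 x) - fourier_partial_sum N (spike_tail 0) x))\<^sup>2)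
      \<le> (2 * D + 8) * (3 / 4) ^ K" if NK: "N \<ge> stage_grid K ^ 4" for N K
  proof -
    let ?M = "stage_grid K"
    have M: "real ?M > 0" using stage_grid_ge(2)[of K] by simp
    have "1 \<le> ?M ^ 4" using stage_grid_ge(2)[of K] by (intro one_le_power)
    then have N: "N \<ge> 1" using NK by simp
    have "\<forall>k. \<exists>P. P \<in> trig_polys N \<and>
      (LINT x|circle_measure. (cmod (of_bool (x \<in> spike_set k) - P x))\<^sup>2) \<le> 4 * (real (stage_grid k))\<^sup>2 / real N"
      using spike_trig_approximation[OF N] by metis
    then obtain Q where Q: "\<And>k. Q k \<in> trig_polys N"
      "\<And>k. (LINT x|circle_measure. (cmod (of_bool (x \<in> spike_set k) - Q k x))\<^sup>2) \<le> 4 * (real (stage_grid k))\<^sup>2 / real N"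
      by metis
    define e where "e k x = of_bool (x \<in> spike_set k) - Q k x" for k x
    define P where "P x = (\<Sum>k<K. of_nat k * (Q k x - of_real (spike_prob k)))" for x
    have P: "P \<in> trig_polys N"
      unfolding P_def by (intro trig_polys_sum trig_polys_cmult trig_polys_diff Q trig_polys_const)
    have [measurable]: "Q k \<in> borel_measurable borel" for k
      by (intro borel_measurable_continuous_onI trig_polys_continuous[OF Q(1)])
    have [measurable]: "P \<in> borel_measurable borel"
      by (intro borel_measurable_continuous_onI trig_polys_continuous[OF P])
    have int_e: "integrable circle_measure (\<lambda>x. (cmod (e k x))\<^sup>2)" for k
    proof -
      obtain B where B: "\<And>x. cmod (Q k x) \<le> B" using trig_polys_bounded[OF Q(1)] by blast
      have "cmod (e k x) \<le> 1 + B" for x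
        unfolding e_def using B[of x] by (intro order_trans[OF norm_triangle_ineq4] add_mono) auto
      then have "norm ((cmod (e k x))\<^sup>2) \<le> (1 + B)\<^sup>2" for x
        by (simp add: power_mono)
      moreover have "(\<lambda>x. (cmod (e k x))\<^sup>2) \<in> borel_measurable borel"
        unfolding e_def by measurable
      ultimately show ?thesis
        by (intro integrable_circle_bounded measurable_circle)
    qed
    \<comment> \<open>The bound comes from \<open>(a + b)^2 \<le> 2 * a^2 + 2 * b^2\<close> and
      Cauchy-Schwarz over the \<open>K\<close> early stages.\<close>
    let ?G = "\<lambda>x. 2 * (spike_tail K x)\<^sup>2 + 2 * real K * (\<Sum>k<K. (real k)\<^sup>2 * (cmod (e k x))\<^sup>2)"
    have pw: "AE x in circle_measure. (cmod (of_real (spike_tail 0 x) - P x))\<^sup>2 \<le> ?G x"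
      using AE_finite_spikes
    proof eventually_elim
      case (elim x)
      let ?S = "\<Sum>k<K. of_nat k * e k x"
      have "complex_of_real (\<Sum>k<K. spike k x) = ?S + P x"
        unfolding P_def of_real_sum sum.distrib[symmetric]
        by (intro sum.cong refl) (simp add: spike_def e_def indicator_def algebra_simps)
      then have "of_real (spike_tail 0 x) - P x = of_real (spike_tail K x) + ?S"
        unfolding spike_tail_split[OF elim, of K] of_real_add by simp
      then have "cmod (of_real (spike_tail 0 x) - P x) \<le> \<bar>spike_tail K x\<bar> + cmod ?S"
        using norm_triangle_ineq[of "of_real (spike_tail K x)" ?S] by simp
      then have "(cmod (of_real (spike_tail 0 x) - P x))\<^sup>2 \<le> (\<bar>spike_tail K x\<bar> + cmod ?S)\<^sup>2"
        by (intro power_mono) auto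
      also have "\<dots> \<le> 2 * (spike_tail K x)\<^sup>2 + 2 * (cmod ?S)\<^sup>2"
        using zero_le_power2[of "\<bar>spike_tail K x\<bar> - cmod ?S"] by (simp add: power2_eq_square algebra_simps)
      also have "(cmod ?S)\<^sup>2 \<le> (\<Sum>k<K. real k * cmod (e k x))\<^sup>2"
        by (intro power_mono order_trans[OF norm_sum]) (auto simp: norm_mult)
      also have "(\<Sum>k<K. real k * cmod (e k x))\<^sup>2 \<le> (\<Sum>k<K. (real k * cmod (e k x))\<^sup>2) * real K"
        using sum_squared_le_sum_of_squares[of "\<lambda>k. real k * cmod (e k x)" "{..<K}"] by simp
      finally show ?case by (simp add: power_mult_distrib mult_ac)
    qed
    have int_G: "integrable circle_measure ?G"
      by (intro Bochner_Integration.integrable_add integrable_mult_right Bochner_Integration.integrable_sum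
          int_tail int_e)
    have "(LINT x|circle_measure. (cmod (of_real (spike_tail 0 x) - fourier_partial_sum N (spike_tail 0) x))\<^sup>2)
        \<le> (LINT x|circle_measure. (cmod (of_real (spike_tail 0 x) - P x))\<^sup>2)"
      by (intro fourier_partial_sum_best_approximation int_tail P measurable_circle spike_tail_measurable)
    also have "\<dots> \<le> (LINT x|circle_measure. ?G x)"
    proof (rule integral_mono_AE[OF _ int_G pw])
      show "integrable circle_measure (\<lambda>x. (cmod (of_real (spike_tail 0 x) - P x))\<^sup>2)"
        using pw by (intro Bochner_Integration.integrable_bound[OF int_G] measurable_circle)
          (auto elim!: eventually_mono)
    qed
    also have "\<dots> = 2 * (LINT x|circle_measure. (spike_tail K x)\<^sup>2)
        + 2 * real K * (\<Sum>k<K. (real k)\<^sup>2 * (LINT x|circle_measure. (cmod (e k x))\<^sup>2))"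
      by (simp only: Bochner_Integration.integral_add integrable_mult_right Bochner_Integration.integrable_sum
          int_tail int_e integral_mult_right_zero Bochner_Integration.integral_sum)
    also have "\<dots> \<le> 2 * (D * (3 / 4) ^ K) + 2 * real K * (\<Sum>k<K. (real K)\<^sup>2 * (4 * (real ?M)\<^sup>2 / real N))"
    proof (intro add_mono mult_left_mono D sum_mono mult_mono)
      fix k assume k: "k \<in> {..<K}"
      have "(LINT x|circle_measure. (cmod (e k x))\<^sup>2) \<le> 4 * (real (stage_grid k))\<^sup>2 / real N"
        using Q(2)[of k] by (simp add: e_def)
      also have "\<dots> \<le> 4 * (real ?M)\<^sup>2 / real N"
        using k stage_grid_mono[of k K] by (intro divide_right_mono mult_left_mono power_mono) auto
      finally show "(LINT x|circle_measure. (cmod (e k x))\<^sup>2) \<le> 4 * (real ?M)\<^sup>2 / real N" .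
      show "(real k)\<^sup>2 \<le> (real K)\<^sup>2" using k by (intro power_mono) auto
    qed auto
    also have "2 * real K * (\<Sum>k<K. (real K)\<^sup>2 * (4 * (real ?M)\<^sup>2 / real N)) = 8 * (real K ^ 4 * (real ?M)\<^sup>2 / real N)"
      by (simp add: power2_eq_square power4_eq_xxxx)
    \<comment> \<open>The threshold for \<open>N\<close> leaves \<open>M^2 / N\<close> at most
      \<open>1 / M^2\<close>, so the factor \<open>K^4\<close> meets the square of a quantity
      exponentially larger than \<open>K^2\<close>.\<close>
    also have "real K ^ 4 * (real ?M)\<^sup>2 / real N \<le> real K ^ 4 * (real ?M)\<^sup>2 / real (?M ^ 4)"
      using NK M by (intro divide_left_mono mult_pos_pos) (use N in \<open>auto simp flip: of_nat_power\<close>)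
    also have "\<dots> = ((real K)\<^sup>2 / real ?M)\<^sup>2"
      using M by (simp add: field_simps power2_eq_square power4_eq_xxxx)
    also have "\<dots> \<le> ((1 / 2) ^ K)\<^sup>2"
    proof (intro power_mono)
      have "real (2 ^ K * K\<^sup>2) \<le> real ?M" using stage_grid_ge(1) of_nat_le_iff by blast
      then show "(real K)\<^sup>2 / real ?M \<le> (1 / 2) ^ K"
        using M by (simp add: field_simps)
    qed auto
    also have "((1 / 2 :: real) ^ K)\<^sup>2 \<le> (3 / 4) ^ K"
      unfolding power_mult[symmetric] mult.commute[of K] unfolding power_mult
      by (intro power_mono) (auto simp: power2_eq_square)
    finally show ?thesis by (simp add: ring_distribs)
  qed
  then show ?thesis using that[of "2 * D + 8"] D(1) by simp
qed

text \<open>For \<open>y = ln (ln (ln N))\<close> the choice of \<open>K\<close> near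
  \<open>y / 6\<close> keeps the fourth power of the grid size below \<open>N\<close>. The error is
  then exponentially small in \<open>y\<close>, which beats every negative power of
  \<open>y\<close>.\<close>

lemma spike_L2_rate:
  assumes C: "C > 0"
  shows "\<exists>K>0. \<forall>\<^sub>F N in sequentially.
     L2_norm_circle (\<lambda>x. of_real (spike_tail 0 x) - fourier_partial_sum N (spike_tail 0) x)
       \<le> K * ln (ln (ln (real N))) powr (- C)"
proof -
  obtain D where D: "D > 0" "\<And>N K. N \<ge> stage_grid K ^ 4 \<Longrightarrow>
    (LINT x|circle_measure. (cmod (of_real (spike_tail 0 x) - fourier_partial_sum N (spike_tail 0) x))\<^sup>2)
      \<le> D * (3 / 4) ^ K"
    using spike_partial_sum_dist by blast
  have top: "filterlim (\<lambda>N. ln (ln (ln (real N)))) at_top sequentially" by real_asymp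
  \<comment> \<open>The exponent is doubled because the square of the norm is estimated; the root is
    taken at the end.\<close>
  have "eventually (\<lambda>y::real. (3 / 4) powr (y / 6 - 1) \<le> y powr (- 2 * C)) at_top"
    using C by real_asymp
  from eventually_compose_filterlim[OF this top]
  have ev1: "\<forall>\<^sub>F N in sequentially. (3 / 4) powr (ln (ln (ln (real N))) / 6 - 1) \<le> ln (ln (ln (real N))) powr (- 2 * C)" .
  have ev2: "\<forall>\<^sub>F N in sequentially. ln (ln (ln (real N))) \<ge> 6 \<and> ln (ln (real N)) > 0 \<and> ln (real N) > 0 \<and> real N > 0"
    by (intro eventually_conj) real_asymp+
  have "\<forall>\<^sub>F N in sequentially.
     L2_norm_circle (\<lambda>x. of_real (spike_tail 0 x) - fourier_partial_sum N (spike_tail 0) x)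
       \<le> sqrt D * ln (ln (ln (real N))) powr (- C)"
    using ev1 ev2
  proof eventually_elim
    case (elim N)
    define y where "y = ln (ln (ln (real N)))"
    \<comment> \<open>The divisor 6 cancels the constant in \<open>stage_grid_le\<close>; rounding
      down costs the \<open>- 1\<close> in the exponent above.\<close>
    define K where "K = nat \<lfloor>y / 6\<rfloor>"
    have y: "y \<ge> 6" using elim by (simp add: y_def)
    have K: "K \<ge> 1" "real K \<le> y / 6" "y / 6 - 1 \<le> real K"
      using y by (auto simp: K_def le_nat_floor of_nat_floor) linarith
    have "real (stage_grid K ^ 4) \<le> exp (exp (exp (6 * real K)))" by (rule stage_grid_le[OF K(1)])
    also have "\<dots> \<le> exp (exp (exp y))" using K(2) by simp
    also have "\<dots> = real N" using elim by (simp add: y_def)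
    finally have "stage_grid K ^ 4 \<le> N" by (simp only: of_nat_le_iff)
    note D(2)[OF this]
    also have "D * (3 / 4) ^ K \<le> D * y powr (- 2 * C)"
    proof (intro mult_left_mono)
      have "(3 / 4 :: real) ^ K = (3 / 4) powr real K" by (simp add: powr_realpow)
      also have "\<dots> \<le> (3 / 4) powr (y / 6 - 1)" using K(3) by (intro powr_mono') auto
      also have "\<dots> \<le> y powr (- 2 * C)" using elim by (simp add: y_def)
      finally show "(3 / 4) ^ K \<le> y powr (- 2 * C)" .
    qed (use D(1) in auto)
    finally have "L2_norm_circle (\<lambda>x. of_real (spike_tail 0 x) - fourier_partial_sum N (spike_tail 0) x)
        \<le> sqrt (D * y powr (- 2 * C))"
      unfolding L2_norm_circle_def by (rule real_sqrt_le_mono)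
    also have "y powr (- 2 * C) = (y powr (- C))\<^sup>2"
      using y by (simp add: power2_eq_square powr_add[symmetric])
    finally show ?case by (simp add: real_sqrt_mult y_def)
  qed
  then show ?thesis using D(1) by (intro exI[of _ "sqrt D"]) auto
qed

section \<open>Divergence of the averages\<close>

text \<open>Halving the binary logarithm gives the integer part of the logarithm to base 4.\<close>

definition stage :: "nat \<Rightarrow> nat" where
  "stage t = floor_log t div 2"

text \<open>\<open>t\<close> is the number of the dyadic block of \<open>j\<close>. The summand
  \<open>t * stage_length k\<close> starts a fresh window of digits for each block, and
  \<open>j\<close> shifts the starting digit inside the window.\<close>

definition dilation :: "nat \<Rightarrow> nat" where
  "dilation j = (let t = floor_log j; k = stage t in stage_base k ^ (t * stage_length k + j))"

lemma stage_mono: "s \<le> t \<Longrightarrow> stage s \<le> stage t"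
  unfolding stage_def by (intro div_le_mono floor_log_le_iff)

lemma stage_eqI:
  assumes "4 ^ k \<le> t" "t < 4 ^ (k + 1)"
  shows "stage t = k"
proof -
  have 4: "(4 :: nat) ^ m = 2 ^ (2 * m)" for m by (simp add: power_mult)
  have t: "t > 0" using assms(1) by (metis gr0I not_le zero_less_numeral zero_less_power)
  have "2 ^ (2 * k) \<le> t" "t < 2 ^ (2 * k + 2)" using assms by (simp_all add: 4)
  then have "2 ^ (2 * k) < 2 * (2 :: nat) ^ floor_log t" "(2 :: nat) ^ floor_log t < 2 ^ (2 * k + 2)"
    using floor_log_exp2_gt[of t] floor_log_exp2_le[OF t] by linarith+
  then have "2 * k < Suc (floor_log t)" "floor_log t < 2 * k + 2"
    by (simp_all only: power_Suc[symmetric] power_strict_increasing_iff[OF one_less_numeral_iff[THEN iffD2]] semiring_norm)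
  then show ?thesis unfolding stage_def by simp
qed

lemma dilation_pos: "dilation j > 0"
  unfolding dilation_def Let_def using stage_base_ge by (simp add: zero_less_power order.strict_trans2[of 0 2])

text \<open>The exponent grows by at least one and the base never decreases, also when a new block
  or a new stage begins; the base is at least 2.\<close>

lemma dilation_Suc: "2 * dilation j \<le> dilation (Suc j)"
proof -
  define t where "t = floor_log j"
  define t' where "t' = floor_log (Suc j)"
  have tt: "t \<le> t'" unfolding t_def t'_def by (intro floor_log_le_iff) simp
  have kk: "stage t \<le> stage t'" by (rule stage_mono[OF tt])
  define e where "e = t * stage_length (stage t) + j"
  define e' where "e' = t' * stage_length (stage t') + Suc j"
  have "Suc e \<le> e'" unfolding e_def e'_def
    using tt kk by (simp add: add_mono mult_mono stage_length_mono)
  have "2 * stage_base (stage t) ^ e \<le> stage_base (stage t) ^ Suc e"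
    using stage_base_ge by simp
  also have "\<dots> \<le> stage_base (stage t') ^ Suc e"
    by (intro power_mono stage_base_mono kk) simp
  also have "\<dots> \<le> stage_base (stage t') ^ e'"
    using \<open>Suc e \<le> e'\<close> stage_base_ge[of "stage t'"] by (intro power_increasing) auto
  finally show ?thesis
    unfolding dilation_def Let_def t_def[symmetric] t'_def[symmetric] e_def e'_def .
qed

lemma dilation_strict_mono: "strict_mono dilation"
proof (rule strict_mono_Suc_iff[THEN iffD2], rule allI)
  show "dilation j < dilation (Suc j)" for j
    using dilation_Suc[of j] dilation_pos[of j] by linarith
qed

text \<open>The upper half of the window of each block of stage \<open>k\<close>. Every
  \<open>j\<close> in such a block lies below half the window length, so a zero at one of these
  positions is seen by all dilates of the block.\<close>

definition stage_positions :: "nat \<Rightarrow> nat set" where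
  "stage_positions k = (\<lambda>(t, i). t * stage_length k + i) `
     ({4 ^ k..<4 ^ (k + 1)} \<times> {stage_length k div 2..<stage_length k})"

definition missed_set :: "nat \<Rightarrow> real set" where
  "missed_set k = {x \<in> {0..<1}. \<forall>i\<in>stage_positions k. x \<notin> zero_digit (stage_base k) i}"

text \<open>There are \<open>3 * 4 ^ k\<close> disjoint windows with \<open>H / 2\<close> positions
  each, while the target is \<open>k * 2 ^ k * H\<close>; it suffices that \<open>k * 2 ^ k\<close>
  is at most \<open>4 ^ k\<close>. A multiple \<open>k\<close> of the base makes missing all
  positions exponentially unlikely in \<open>k\<close>.\<close>

lemma card_stage_positions: "card (stage_positions k) \<ge> k * stage_base k"
proof -
  let ?H = "stage_length k"
  have H: "?H = 2 * (?H div 2)" by (simp add: stage_length_def)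
  have "inj_on (\<lambda>(t, i). t * ?H + i) ({4 ^ k..<4 ^ (k + 1)} \<times> {?H div 2..<?H})"
  proof (rule inj_on_inverseI[where g = "\<lambda>n. (n div ?H, n mod ?H)"])
  qed auto
  then have "card (stage_positions k) = (4 ^ (k + 1) - 4 ^ k) * (?H - ?H div 2)"
    unfolding stage_positions_def by (subst card_image) (auto simp: card_cartesian_product)
  also have "?H - ?H div 2 = ?H div 2" using H by linarith
  also have "4 ^ (k + 1) - 4 ^ k = 3 * (4 ^ k :: nat)" by simp
  finally have c: "card (stage_positions k) = 3 * 4 ^ k * (?H div 2)" .
  have "k * 2 ^ k \<le> 2 ^ k * (2 :: nat) ^ k"
    using less_exp[of k] by (intro mult_right_mono) auto
  also have "\<dots> = 4 ^ k" by (simp flip: power_mult_distrib)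
  finally have "2 * (k * 2 ^ k) * (?H div 2) \<le> 3 * 4 ^ k * (?H div 2)"
    by (intro mult_right_mono) auto
  moreover have "k * stage_base k = 2 * (k * 2 ^ k) * (?H div 2)"
  proof -
    have "k * stage_base k = k * (2 ^ k * (2 * (?H div 2)))"
      unfolding stage_base_def using H by (rule arg_cong)
    then show ?thesis by (simp only: mult_ac)
  qed
  ultimately show ?thesis using c by linarith
qed

text \<open>Each batch of \<open>b\<close> independent positions is missed with probability
  \<open>(1 - 1 / b) ^ b\<close>, at most \<open>exp (- 1)\<close> and hence at most 1/2; there are
  at least \<open>k\<close> batches.\<close>

lemma measure_missed_set: "measure circle_measure (missed_set k) \<le> (1 / 2) ^ k"
proof -
  let ?b = "stage_base k" and ?n = "card (stage_positions k)"
  have b: "real ?b \<ge> 2" using stage_base_ge[of k] by linarith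
  have "finite (stage_positions k)" by (simp add: stage_positions_def)
  then have "measure circle_measure (missed_set k) = (1 - 1 / real ?b) ^ ?n"
    unfolding missed_set_def using b by (intro measure_nonzero_digits) auto
  also have "\<dots> \<le> (1 - 1 / real ?b) ^ (?b * k)"
    using b card_stage_positions[of k] by (intro power_decreasing) (auto simp: mult.commute)
  also have "\<dots> = ((1 - 1 / real ?b) ^ ?b) ^ k" by (rule power_mult)
  also have "\<dots> \<le> (1 / 2) ^ k"
  proof (rule power_mono)
    have "1 - 1 / real ?b \<le> exp (- (1 / real ?b))" using exp_ge_add_one_self[of "- (1 / real ?b)"] by simp
    then have "(1 - 1 / real ?b) ^ ?b \<le> exp (- (1 / real ?b)) ^ ?b"
      using b by (intro power_mono) auto
    also have "\<dots> = exp (- 1)" using b by (simp add: exp_of_nat_mult[symmetric])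
    also have "\<dots> \<le> 1 / 2"
      using exp_ge_add_one_self[of 1] by (simp add: exp_minus field_simps)
    finally show "(1 - 1 / real ?b) ^ ?b \<le> 1 / 2" .
  qed (use b in auto)
  finally show ?thesis .
qed

section \<open>Exceptional null sets and divergence almost everywhere\<close>

lemma AE_not_missed: "AE x in circle_measure. eventually (\<lambda>k. x \<notin> missed_set k) sequentially"
proof -
  have "AE x in circle_measure. eventually (\<lambda>k. x \<in> space circle_measure - missed_set k) sequentially"
  \<comment> \<open>The missing probabilities are summable, so almost every point succeeds in all
    late stages, not just in infinitely many.\<close>
  proof (rule borel_cantelli_AE1)
    show "missed_set k \<in> sets circle_measure" for k
    proof -
      have "finite (stage_positions k)" by (simp add: stage_positions_def)
      then have "- (\<Union>i\<in>stage_positions k. zero_digit (stage_base k) i) \<in> sets borel"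
        by (intro borel_comp sets.finite_UN) auto
      from sets_circle_borel[OF this] show ?thesis by (simp add: missed_set_def)
    qed
    show "emeasure circle_measure (missed_set k) < \<infinity>" for k
      using finite_measure.emeasure_finite[OF finite_measure_circle] by (simp add: less_top)
    show "summable (\<lambda>k. measure circle_measure (missed_set k))"
    proof (rule summable_comparison_test')
      show "summable (\<lambda>k. (1 / 2 :: real) ^ k)" by (rule summable_geometric) simp
      show "norm (measure circle_measure (missed_set k)) \<le> (1 / 2) ^ k" if "k \<ge> 0" for k
        using measure_missed_set[of k] by simp
    qed
  qed
  then show ?thesis by eventually_elim (auto elim: eventually_mono)
qed

text \<open>Dilated points leave \<open>[0, 1)\<close>, so the exceptional set is first spread over
  the line by its countably many integer translates and remains null. Its preimage under each
  dilation is null, and there are countably many dilations.\<close>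

lemma AE_finite_spikes_dilates:
  "AE x in circle_measure. \<forall>j. finite {k. real (dilation j) * x \<in> spike_set k}"
proof -
  define B where "B = {x. infinite {k. x \<in> spike_set k}}"
  have B_1: "x + 1 \<in> B \<longleftrightarrow> x \<in> B" for x by (simp add: B_def spike_set_add_1)
  interpret B: periodic_fun_simple' "\<lambda>x. x \<in> B"
    by unfold_locales (simp add: B_1)
  have B_int: "x + of_int z \<in> B \<longleftrightarrow> x \<in> B" for x z by (rule B.plus_of_int)
  have "negligible (B \<inter> {0..<1})"
  proof -
    have "AE x in lebesgue. x \<in> {0..<1} \<longrightarrow> finite {k. x \<in> spike_set k}"
      using AE_finite_spikes unfolding circle_measure_def by (subst (asm) AE_restrict_space_iff) auto
    then obtain N where N: "N \<in> null_sets lebesgue"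
      "{x \<in> space lebesgue. \<not> (x \<in> {0..<1} \<longrightarrow> finite {k. x \<in> spike_set k})} \<subseteq> N"
      unfolding eventually_ae_filter by blast
    have "B \<inter> {0..<1} \<subseteq> N" using N(2) by (auto simp: B_def)
    then show ?thesis using N(1) negligible_iff_null_sets negligible_subset by blast
  qed
  then have "negligible (\<Union>z::int. (+) (of_int z) ` (B \<inter> {0..<1}))"
    by (intro negligible_countable_Union) (auto intro: negligible_translation)
  moreover have "B \<subseteq> (\<Union>z::int. (+) (of_int z) ` (B \<inter> {0..<1}))"
  proof
    fix x assume "x \<in> B"
    then have "frac x \<in> B \<inter> {0..<1}"
      using B_int[of "frac x" "\<lfloor>x\<rfloor>"] by (simp add: frac_def frac_lt_1[unfolded frac_def])
    then have "of_int \<lfloor>x\<rfloor> + frac x \<in> (\<Union>z::int. (+) (of_int z) ` (B \<inter> {0..<1}))" by blast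
    then show "x \<in> (\<Union>z::int. (+) (of_int z) ` (B \<inter> {0..<1}))" by (simp add: frac_def)
  qed
  ultimately have negl: "negligible B" by (rule negligible_subset)
  have "AE x in lebesgue. finite {k. real (dilation j) * x \<in> spike_set k}" for j
  proof -
    have "negligible ((*) (1 / real (dilation j)) ` B)"
      using negl by (intro negligible_differentiable_image_negligible) (auto intro!: derivative_intros simp: differentiable_on_def)
    moreover have "{x \<in> space lebesgue. \<not> finite {k. real (dilation j) * x \<in> spike_set k}}
        \<subseteq> (*) (1 / real (dilation j)) ` B"
    proof
      fix x assume "x \<in> {x \<in> space lebesgue. \<not> finite {k. real (dilation j) * x \<in> spike_set k}}"
      then have "real (dilation j) * x \<in> B" by (simp add: B_def)
      then show "x \<in> (*) (1 / real (dilation j)) ` B"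
        using dilation_pos[of j] by (intro image_eqI[of _ _ "real (dilation j) * x"]) auto
    qed
    ultimately show ?thesis
      unfolding eventually_ae_filter negligible_iff_null_sets by blast
  qed
  then have "AE x in lebesgue. \<forall>j. finite {k. real (dilation j) * x \<in> spike_set k}"
    by (simp add: AE_all_countable)
  then show ?thesis
    unfolding circle_measure_def by (subst AE_restrict_space_iff) auto
qed

text \<open>A zero at position \<open>t * H + i\<close> becomes, after the dilation with index
  \<open>j\<close>, a zero at index \<open>i - j\<close>, which lies below \<open>H\<close> for
  every \<open>j\<close> in block \<open>t\<close>.\<close>

lemma dilation_hits_spike:
  assumes x: "x \<in> {0..<1}" "x \<notin> missed_set k"
  obtains t where "4 ^ k \<le> t" "\<And>j. j \<in> {2 ^ t..<2 ^ (t + 1)} \<Longrightarrow> real (dilation j) * x \<in> spike_set k"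
proof -
  let ?H = "stage_length k" and ?b = "stage_base k"
  obtain t i where t: "4 ^ k \<le> t" "t < 4 ^ (k + 1)" and i: "?H div 2 \<le> i" "i < ?H"
    and z: "x \<in> zero_digit ?b (t * ?H + i)"
    using x unfolding missed_set_def stage_positions_def by auto
  have "real (dilation j) * x \<in> spike_set k" if j: "j \<in> {2 ^ t..<2 ^ (t + 1)}" for j
  proof -
    have fl: "floor_log j = t" using j by (intro floor_log_eqI) auto
    have dil: "dilation j = ?b ^ (t * ?H + j)"
      by (simp add: dilation_def Let_def fl stage_eqI[OF t])
    \<comment> \<open>The extra factor 2 in \<open>stage_length\<close> puts every \<open>j\<close>
      of the block below half the window, hence before \<open>i\<close>, so the subtraction
      \<open>i - j\<close> is not truncated.\<close>
    have "j < 2 ^ (t + 1)" using j by simp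
    also have "\<dots> \<le> 2 ^ (4 ^ (k + 1))" using t by (intro power_increasing) auto
    also have "\<dots> = ?H div 2" by (simp add: stage_length_def)
    finally have "j < i" using i by simp
    then have "t * ?H + i = (t * ?H + j) + (i - j)" by simp
    then have "real (dilation j) * x \<in> zero_digit ?b (i - j)"
      unfolding dil zero_digit_power_mult using z by simp
    moreover have "i - j < ?H" using i by simp
    ultimately show ?thesis unfolding spike_set_def by blast
  qed
  then show ?thesis using t(1) that by blast
qed

text \<open>\<open>N\<close> is the last index of block \<open>t\<close>, which makes up more than
  half of the indices up to \<open>N\<close>. Each index of the block contributes at least
  \<open>k\<close> minus the mean, and every earlier one at least minus the mean.\<close>

lemma spike_average_ge:
  assumes fin: "\<And>j. finite {k. real (dilation j) * x \<in> spike_set k}"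
    and hit: "\<And>j. j \<in> {2 ^ t..<2 ^ (t + 1)} \<Longrightarrow> real (dilation j) * x \<in> spike_set k"
    and N: "N = 2 ^ (t + 1) - 1"
  shows "1 / real N * (\<Sum>j = 1..N. spike_tail 0 (real (dilation j) * x)) \<ge> real k / 2 - spike_mean 0"
proof -
  have "Suc N = 2 * 2 ^ t" unfolding N by simp
  moreover from this have "real (Suc N) = 2 * 2 ^ t" by (simp only: of_nat_mult of_nat_power of_nat_numeral)
  moreover have "(2 :: nat) ^ t \<ge> 1" by simp
  ultimately have N1: "N \<ge> 1" "real N = 2 * 2 ^ t - 1" by linarith+
  have "real k * 2 ^ t - real N * spike_mean 0
      = (\<Sum>j = 1..N. real k * of_bool (j \<in> {2 ^ t..<2 ^ (t + 1)}) - spike_mean 0)"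
  proof -
    have "{1..N} \<inter> {j. j \<in> {2 ^ t..<2 ^ (t + 1)}} = {2 ^ t..<2 ^ (t + 1)}"
      unfolding N by auto
    then show ?thesis
      by (simp add: sum_subtractf sum_distrib_left[symmetric] of_bool_def sum.If_cases)
  qed
  also have "\<dots> \<le> (\<Sum>j = 1..N. spike_tail 0 (real (dilation j) * x))"
  proof (rule sum_mono)
    fix j
    have "of_bool (j \<in> {2 ^ t..<2 ^ (t + 1)}) \<le> (indicator (spike_set k) (real (dilation j) * x) :: real)"
      using hit[of j] by (auto simp: indicator_def)
    then have "real k * of_bool (j \<in> {2 ^ t..<2 ^ (t + 1)}) \<le> real k * indicator (spike_set k) (real (dilation j) * x)"
      by (intro mult_left_mono) auto
    then show "real k * of_bool (j \<in> {2 ^ t..<2 ^ (t + 1)}) - spike_mean 0 \<le> spike_tail 0 (real (dilation j) * x)"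
      using spike_tail_lower_bound[OF fin[of j], of k] by linarith
  qed
  finally have "1 / real N * (real k * 2 ^ t - real N * spike_mean 0)
      \<le> 1 / real N * (\<Sum>j = 1..N. spike_tail 0 (real (dilation j) * x))"
    by (intro mult_left_mono) auto
  moreover have "1 / real N * (real k * 2 ^ t - real N * spike_mean 0) = real k * (2 ^ t / real N) - spike_mean 0"
    using N1(1) by (simp add: field_simps)
  moreover have "real k * (1 / 2) \<le> real k * (2 ^ t / real N)"
    using N1 by (intro mult_left_mono) (auto simp: field_simps)
  ultimately show ?thesis by simp
qed

lemma spike_limsup:
  "AE x in circle_measure.
     limsup (\<lambda>N. ereal (1 / real N * (\<Sum>j = 1..N. spike_tail 0 (real (dilation j) * x)))) = \<infinity>"
  using AE_not_missed AE_finite_spikes_dilates AE_space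
proof eventually_elim
  case (elim x)
  let ?a = "\<lambda>N. ereal (1 / real N * (\<Sum>j = 1..N. spike_tail 0 (real (dilation j) * x)))"
  have x: "x \<in> {0..<1}" using elim by simp
  obtain k0 where k0: "\<And>k. k \<ge> k0 \<Longrightarrow> x \<notin> missed_set k"
    using elim by (auto simp: eventually_sequentially)
  show ?case
  proof (rule ccontr)
    assume "limsup ?a \<noteq> \<infinity>"
    then obtain r where "limsup ?a < ereal (real r)" using less_PInf_Ex_of_nat by blast
    then have "eventually (\<lambda>N. ?a N < ereal (real r)) sequentially" by (rule Limsup_lessD)
    then obtain N0 where N0: "\<And>N. N \<ge> N0 \<Longrightarrow> ?a N < ereal (real r)"
      by (auto simp: eventually_sequentially)
      obtain m where m: "2 * (real r + spike_mean 0) \<le> real m" using real_arch_simple by blast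
      \<comment> \<open>\<open>k0\<close> guarantees a successful block, \<open>N0\<close> pushes
        its end beyond \<open>N0\<close>, and \<open>m\<close> lifts the lower bound for the average
        to \<open>r\<close>.\<close>
      define k where "k = max k0 (max N0 m)"
      obtain t where t: "4 ^ k \<le> t"
        "\<And>j. j \<in> {2 ^ t..<2 ^ (t + 1)} \<Longrightarrow> real (dilation j) * x \<in> spike_set k"
        using dilation_hits_spike[OF x k0[of k]] by (auto simp: k_def)
      define N where "N = (2 :: nat) ^ (t + 1) - 1"
      have "real k / 2 - spike_mean 0 \<le> 1 / real N * (\<Sum>j = 1..N. spike_tail 0 (real (dilation j) * x))"
        by (rule spike_average_ge[OF _ t(2) N_def]) (use elim in auto)
      moreover have "real r \<le> real k / 2 - spike_mean 0"
        using m by (auto simp: k_def)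
      ultimately have "ereal (real r) \<le> ?a N" by (simp only: ereal_less_eq)
      moreover have "N \<ge> N0"
      proof -
        have "N0 \<le> k" by (simp add: k_def)
        also have "k < 4 ^ k" by (rule order.strict_trans1[OF _ power_gt_expt]) auto
        also have "4 ^ k \<le> t" by (rule t)
        also have "t < 2 ^ t" by (rule less_exp)
        finally show ?thesis by (simp add: N_def)
      qed
      ultimately show False using N0[of N] by simp
  qed
qed

theorem corollary1p4:
  fixes C :: real
  assumes "C > 0"
  shows "\<exists>(f :: real \<Rightarrow> real) (n :: nat \<Rightarrow> nat).
      f \<in> (\<Inter>p\<in>{1..}. Lp_circle p) \<and>
      (LINT x|circle_measure. f x) = 0 \<and>
      (\<forall>j\<ge>1. n j > 0) \<and>
      strict_mono_on {1..} n \<and>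
      (\<forall>j\<ge>1. real (n (j + 1)) / real (n j) \<ge> 2) \<and>
      (\<exists>K>0. \<forall>\<^sub>F N in sequentially.
         L2_norm_circle (\<lambda>x. of_real (f x) - fourier_partial_sum N f x)
           \<le> K * ln (ln (ln (real N))) powr (- C)) \<and>
      (AE x in circle_measure.
         limsup (\<lambda>N. ereal (1 / real N * (\<Sum>j = 1..N. f (real (n j) * x)))) = \<infinity>)"
proof (intro exI[of _ "spike_tail 0"] exI[of _ dilation] conjI)
  show "spike_tail 0 \<in> (\<Inter>p\<in>{1..}. Lp_circle p)" using spike_tail_Lp by auto
  show "(LINT x|circle_measure. spike_tail 0 x) = 0" by (rule spike_tail_integral_0)
  show "\<forall>j\<ge>1. dilation j > 0" by (simp add: dilation_pos)
  show "strict_mono_on {1..} dilation"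
    using dilation_strict_mono by (simp add: strict_mono_on_def strict_mono_def)
  show "\<forall>j\<ge>1. real (dilation (j + 1)) / real (dilation j) \<ge> 2"
  proof (intro allI impI)
    fix j
    have "real (2 * dilation j) \<le> real (dilation (j + 1))"
      unfolding of_nat_le_iff using dilation_Suc[of j] by simp
    then show "real (dilation (j + 1)) / real (dilation j) \<ge> 2"
      using dilation_pos[of j] by (simp add: le_divide_eq)
  qed
qed (rule spike_L2_rate[OF assms] spike_limsup)+

end
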